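(* (a) For $n\ge4$, the matroid ${\mathcal M}_{g_{1,1,0}}(K_n)$ (the even cycle matroid) is the unique maximal $C_4$-matroid on $K_n$ and its rank function is ${\rm val}_{C_4}$. (b) For $n\ge7$, ${\mathcal M}_{g_{2,1,2}}(K_n)$ is the unique maximal $\{K_5^-,K_{3,4}\}$-matroid on $K_n$ and its rank function is ${\rm val}_{\{K_5^-,K_{3,4}\}}$.
   Context: For $F\subseteq E(K_n)$, $V(F)$ is the set of vertices incident to $F$ and $\beta(F)$ is the number of bipartite connected components of the graph $(V(F),F)$. For integers $a\ge b\ge0$ and $c$, $g_{a,b,c}(F)=a|V(F)|-b\beta(F)-c$, and ${\mathcal M}_{g_{a,b,c}}(K_n)$ is the matroid on $E(K_n)$ whose independent sets are those $F$ with $|I|\le g_{a,b,c}(I)$ for every nonempty $I\subseteq F$. $K_5^-$ is $K_5$ minus an edge, $C_4$ the 4-cycle. For a family ${\mathcal H}$ of graphs, an ${\mathcal H}$-matroid on $K_n$ is a matroid on $E(K_n)$ in which the edge set of every subgraph isomorphic to a member of ${\mathcal H}$ is a circuit; maximality is in the weak order (${\mathcal M}_1\preceq{\mathcal M}_2$ if every independent set of ${\mathcal M}_1$ is independent in ${\mathcal M}_2$). With ${\mathcal X}$ the family of these edge sets: a proper ${\mathcal X}$-sequence is $(X_1,\dots,X_k)$ in ${\mathcal X}$ with $X_i\not\subseteq\bigcup_{j<i}X_j$ for $i\ge2$; ${\rm val}(F,{\mathcal S})=|F\cup\bigcup_iX_i|-k$; ${\rm val}_{\mathcal H}(F)=\min_{\mathcal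 S}{\rm val}(F,{\mathcal S})$. *)

theory Defs
  imports Main
begin

locale matroid =
  fixes carrier :: "'a set" and indep :: "'a set set"
  assumes finite_carrier: "finite carrier"
    and indep_subset_carrier: "I \<in> indep \<Longrightarrow> I \<subseteq> carrier"
    and empty_indep: "{} \<in> indep"
    and indep_subset: "I \<in> indep \<Longrightarrow> J \<subseteq> I \<Longrightarrow> J \<in> indep"
    and augmentation: "I \<in> indep \<Longrightarrow> J \<in> indep \<Longrightarrow> card I < card J \<Longrightarrow>
          \<exists>x\<in>J - I. insert x I \<in> indep"

definition circuit :: "'a set \<Rightarrow> 'a set set \<Rightarrow> 'a set \<Rightarrow> bool" where
  "circuit E \<I> C \<longleftrightarrow> C \<subseteq> E \<and> C \<notin> \<I> \<and> (\<forall>D. D \<subset> C \<longrightarrow> D \<in> \<I>)"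

definition rank_of :: "'a set set \<Rightarrow> 'a set \<Rightarrow> nat" where
  "rank_of \<I> F = Max (card ` {I \<in> \<I>. I \<subseteq> F})"

definition weak_le :: "'a set set \<Rightarrow> 'a set set \<Rightarrow> bool" where
  "weak_le \<I>\<^sub>1 \<I>\<^sub>2 \<longleftrightarrow> (\<forall>I\<in>\<I>\<^sub>1. I \<in> \<I>\<^sub>2)"

text \<open>A simple graph is a pair of a vertex set and a set of two-element edges.\<close>

type_synonym 'a graph = "'a set \<times> 'a set set"

definition all_edges :: "'a set \<Rightarrow> 'a set set" where
  "all_edges V = {e. e \<subseteq> V \<and> card e = 2}"

definition complete_graph :: "nat \<Rightarrow> nat graph" where
  "complete_graph n = ({..<n}, all_edges {..<n})"

definition subgraph :: "'a graph \<Rightarrow> 'a graph \<Rightarrow> bool" where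
  "subgraph G H \<longleftrightarrow> fst G \<subseteq> fst H \<and> snd G \<subseteq> snd H \<and> snd G \<subseteq> all_edges (fst G)"

definition graph_isomorphic :: "'a graph \<Rightarrow> 'b graph \<Rightarrow> bool" where
  "graph_isomorphic G H \<longleftrightarrow>
     (\<exists>f. bij_betw f (fst G) (fst H) \<and> (\<lambda>e. f ` e) ` snd G = snd H)"

definition C4 :: "nat graph" where
  "C4 = ({..<4}, {{0, 1}, {1, 2}, {2, 3}, {3, 0}})"

definition K5_minus :: "nat graph" where
  "K5_minus = ({..<5}, all_edges {..<5} - {{0, 1}})"

definition K34 :: "nat graph" where
  "K34 = ({..<7}, {{i, j} | i j. i \<in> {..<3} \<and> j \<in> {3..<7}})"

definition incident_vertices :: "'a set set \<Rightarrow> 'a set" where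
  "incident_vertices F = \<Union>F"

definition connected_rel :: "'a set set \<Rightarrow> ('a \<times> 'a) set" where
  "connected_rel F = {(u, v). {u, v} \<in> F}\<^sup>*"

definition components :: "'a set set \<Rightarrow> 'a set set" where
  "components F = incident_vertices F // connected_rel F"

definition bipartite :: "'a graph \<Rightarrow> bool" where
  "bipartite G \<longleftrightarrow>
     (\<exists>A B. A \<union> B = fst G \<and> A \<inter> B = {} \<and> (\<forall>e\<in>snd G. \<exists>a\<in>A. \<exists>b\<in>B. e = {a, b}))"

definition beta :: "'a set set \<Rightarrow> nat" where
  "beta F = card {C \<in> components F. bipartite (C, {e \<in> F. e \<subseteq> C})}"

definition g_fun :: "int \<Rightarrow> int \<Rightarrow> int \<Rightarrow> 'a set set \<Rightarrow> int" where
  "g_fun a b c F = a * int (card (incident_vertices F)) - b * int (beta F) - c"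

definition count_indep :: "('a set \<Rightarrow> int) \<Rightarrow> 'a set \<Rightarrow> 'a set set" where
  "count_indep g E = {F. F \<subseteq> E \<and> (\<forall>I. I \<subseteq> F \<and> I \<noteq> {} \<longrightarrow> int (card I) \<le> g I)}"

abbreviation M_g :: "int \<Rightarrow> int \<Rightarrow> int \<Rightarrow> nat \<Rightarrow> nat set set set" where
  "M_g a b c n \<equiv> count_indep (g_fun a b c) (snd (complete_graph n))"

definition copies :: "'b graph set \<Rightarrow> nat \<Rightarrow> nat set set set" where
  "copies \<H> n =
     {snd G | G. subgraph G (complete_graph n) \<and> (\<exists>H\<in>\<H>. graph_isomorphic G H)}"

definition H_matroid :: "'b graph set \<Rightarrow> nat \<Rightarrow> nat set set set \<Rightarrow> bool" where
  "H_matroid \<H> n \<I> \<longleftrightarrow> matroid (snd (complete_graph n)) \<I> \<and>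
     (\<forall>X\<in>copies \<H> n. circuit (snd (complete_graph n)) \<I> X)"

definition maximal_H_matroid :: "'b graph set \<Rightarrow> nat \<Rightarrow> nat set set set \<Rightarrow> bool" where
  "maximal_H_matroid \<H> n \<I> \<longleftrightarrow> H_matroid \<H> n \<I> \<and>
     (\<forall>\<J>. H_matroid \<H> n \<J> \<and> weak_le \<I> \<J> \<longrightarrow> \<J> = \<I>)"

definition unique_maximal_H_matroid :: "'b graph set \<Rightarrow> nat \<Rightarrow> nat set set set \<Rightarrow> bool" where
  "unique_maximal_H_matroid \<H> n \<I> \<longleftrightarrow> maximal_H_matroid \<H> n \<I> \<and>
     (\<forall>\<J>. maximal_H_matroid \<H> n \<J> \<longrightarrow> \<J> = \<I>)"

text \<open>Lists are indexed from 0, so \<open>1 \<le> i\<close> below is the usual condition for all terms but the first.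
  The empty sequence is proper, with value \<open>card F\<close>.\<close>

definition proper_sequence :: "'a set set \<Rightarrow> 'a set list \<Rightarrow> bool" where
  "proper_sequence \<X> Xs \<longleftrightarrow> set Xs \<subseteq> \<X> \<and>
     (\<forall>i. 1 \<le> i \<and> i < length Xs \<longrightarrow> \<not> Xs ! i \<subseteq> (\<Union>j<i. Xs ! j))"

definition val_seq :: "'a set \<Rightarrow> 'a set list \<Rightarrow> int" where
  "val_seq F Xs = int (card (F \<union> \<Union>(set Xs))) - int (length Xs)"

definition val_H :: "'b graph set \<Rightarrow> nat \<Rightarrow> nat set set \<Rightarrow> int" where
  "val_H \<H> n F = Min (val_seq F ` {Xs. proper_sequence (copies \<H> n) Xs})"

text \<open>The minimum in \<^const>\<open>val_H\<close> is over a finite nonempty set.\<close>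

lemma finite_copies: "finite (copies \<H> n)"
proof (rule finite_subset)
  show "copies \<H> n \<subseteq> Pow (Pow {..<n})"
    by (auto simp: copies_def subgraph_def complete_graph_def all_edges_def)
qed simp

lemma finite_proper_sequences:
  assumes "finite \<X>"
  shows "finite {Xs. proper_sequence \<X> Xs}"
proof (rule finite_subset)
  have "distinct Xs" if "proper_sequence \<X> Xs" for Xs
  proof -
    have "Xs ! i \<noteq> Xs ! j" if "i < j" "j < length Xs" for i j
    proof
      assume "Xs ! i = Xs ! j"
      then have "Xs ! j \<subseteq> (\<Union>k<j. Xs ! k)"
        using \<open>i < j\<close> by auto
      then show False
        using \<open>proper_sequence \<X> Xs\<close> that by (auto simp: proper_sequence_def)
    qed
    then show ?thesis
      by (metis distinct_conv_nth linorder_neqE_nat)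
  qed
  then show "{Xs. proper_sequence \<X> Xs} \<subseteq> {Xs. set Xs \<subseteq> \<X> \<and> distinct Xs}"
    by (auto simp: proper_sequence_def)
  show "finite {Xs. set Xs \<subseteq> \<X> \<and> distinct Xs}"
    using assms by (rule finite_subset_distinct)
qed

lemma proper_sequence_Nil: "proper_sequence \<X> []"
  by (simp add: proper_sequence_def)

end

theory Submission
  imports Defs "HOL-Library.Numeral_Type" "HOL-Library.Disjoint_Sets"
begin

text \<open>In any matroid in which the members of \<open>\<X>\<close> are circuits, every proper \<open>\<X>\<close>-sequence bounds the rank
  from above, so it suffices to find, for every \<open>F\<close>, a sequence whose value is the size of a maximal
  independent subset \<open>I\<close> of \<open>F\<close> in the count matroid.  By submodularity \<open>I\<close> is the disjoint union of
  tight sets whose closures cover \<open>F\<close>.  The closure of a tight set is built from complete and complete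
  bipartite graphs, and these are filled up, starting from a free part of the right size, by adding
  one edge at a time as the last missing edge of a copy of \<open>C\<^sub>4\<close>, \<open>K\<^sub>5\<^sup>-\<close> or \<open>K\<^sub>3\<^sub>,\<^sub>4\<close>.

  Submodularity of \<open>|V(F)| - \<beta>(F)\<close> is a dimension count: it is the codimension of the space of
  labellings \<open>x\<close> of the vertices by the field with three elements with \<open>x u + x v = 0\<close> on every edge.\<close>

section \<open>Count matroids\<close>

text \<open>Everything hinges on two counts agreeing: a tight set \<open>T\<close> has exactly
  \<open>g T\<close> edges, and its closure must be reachable with that many free edges. In the even
  cycle case a complete graph is charged |W| and a complete bipartite graph |A| + |B| - 1, one free
  edge per new vertex. For \<open>g_fun 2 1 2\<close> the charges are 2|W| - 2 and 2(|A| + |B|) - 3,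
  two free edges per new vertex, and they are sharp at K_4 (6 edges) and K_{3,3} (9 edges), from
  where the circuits take over. The cases differ in connectivity: with c = 0 a tight set may have
  many components, and its nonbipartite ones close up to a single complete graph; c = 2 forces tight
  sets to be connected. The field needs characteristic other than 2, since otherwise odd cycles
  would impose nothing on labels. Over three elements the nonzero labels are just +1 and -1, so a
  labelling without zeros on a component is a two-colouring, and finiteness turns comparison of
  dimensions into comparison of cardinalities.\<close>

locale count_function =
  fixes E :: "'a set" and g :: "'a set \<Rightarrow> int"
  assumes finite_ground: "finite E"
    and mono: "A \<subseteq> B \<Longrightarrow> B \<subseteq> E \<Longrightarrow> g A \<le> g B"
    and submodular: "A \<subseteq> E \<Longrightarrow> B \<subseteq> E \<Longrightarrow> g (A \<union> B) + g (A \<inter> B) \<le> g A + g B"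
    and singleton: "e \<in> E \<Longrightarrow> g {e} = 1"
begin

definition tight :: "'a set \<Rightarrow> bool" where
  "tight T \<longleftrightarrow> T \<noteq> {} \<and> int (card T) = g T"

text \<open>Closure with respect to \<open>g\<close> rather than to the rank. For tight
  \<open>T\<close> a new element of it breaks independence, since the size grows and
  \<open>g\<close> does not.\<close>

definition cl :: "'a set \<Rightarrow> 'a set" where
  "cl T = {e \<in> E. g (insert e T) = g T}"

lemma indepD:
  assumes "I \<in> count_indep g E"
  shows "I \<subseteq> E" "finite I" "J \<subseteq> I \<Longrightarrow> J \<noteq> {} \<Longrightarrow> int (card J) \<le> g J"
  using assms finite_ground finite_subset by (auto simp: count_indep_def)

text \<open>Submodularity for \<open>T \<union> S\<close> and \<open>insert e T\<close>, which meet
  in a superset of \<open>T\<close>, lets the elements of the closure be added one by one without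
  raising \<open>g\<close>.\<close>

lemma g_cl:
  assumes "T \<subseteq> E"
  shows "g (cl T) \<le> g T"
proof -
  have "g (T \<union> S) \<le> g T" if "finite S" "S \<subseteq> cl T" for S
    using that
  proof (induction S)
    case (insert e S)
    have "g ((T \<union> S) \<union> insert e T) + g ((T \<union> S) \<inter> insert e T) \<le> g (T \<union> S) + g (insert e T)"
      using insert.prems assms by (intro submodular) (auto simp: cl_def)
    moreover have "g T \<le> g ((T \<union> S) \<inter> insert e T)"
      using insert.prems assms by (intro mono) (auto simp: cl_def)
    moreover have "(T \<union> S) \<union> insert e T = T \<union> insert e S"
      by auto
    ultimately show ?case
      using insert by (auto simp: cl_def)
  qed simp
  moreover have "finite (cl T)" "T \<union> cl T = cl T"
    using finite_ground assms by (auto simp: cl_def insert_absorb)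
  ultimately show ?thesis
    by force
qed

text \<open>Uncrossing: the independence inequalities for the union and the intersection add up to
  the equality for \<open>S\<close> and \<open>T\<close>, so both are sharp. The intersection must
  be nonempty because independence says nothing about \<open>{}\<close>, where \<open>g\<close> may
  be negative.\<close>

lemma tight_Un:
  assumes I: "I \<in> count_indep g E" and S: "S \<subseteq> I" "tight S" and T: "T \<subseteq> I" "tight T"
    and "S \<inter> T \<noteq> {}"
  shows "tight (S \<union> T)"
proof -
  note d = indepD[OF I]
  have "g (S \<union> T) + g (S \<inter> T) \<le> g S + g T"
    using d S T by (intro submodular) auto
  moreover have "int (card (S \<inter> T)) \<le> g (S \<inter> T)"
    using d(3)[of "S \<inter> T"] S assms(6) by auto
  moreover have "int (card (S \<union> T)) \<le> g (S \<union> T)"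
    using d(3)[of "S \<union> T"] S T assms(6) by auto
  moreover have "card (S \<union> T) + card (S \<inter> T) = card S + card T"
    using card_Un_Int[of S T] d(2) S T finite_subset by metis
  ultimately show ?thesis
    using S T by (auto simp: tight_def)
qed

text \<open>The parts are the inclusion-maximal tight subsets of \<open>I\<close>, disjoint by
  uncrossing. A rejected element \<open>e\<close> comes with a violating set
  \<open>insert e L'\<close>; then \<open>L'\<close> is tight with \<open>e\<close> in its closure,
  and submodularity carries this over to the part containing \<open>L'\<close>.\<close>

lemma maximal_indep_decomposition:
  assumes I: "I \<in> count_indep g E" and "I \<subseteq> F" and F: "F \<subseteq> E"
    and max: "\<And>e. e \<in> F - I \<Longrightarrow> insert e I \<notin> count_indep g E"
  obtains P where "finite P" "disjoint P" "\<Union>P = I" "\<And>T. T \<in> P \<Longrightarrow> tight T"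
    "F \<subseteq> (\<Union>T\<in>P. cl T)"
proof -
  note d = indepD[OF I]
  define Q where "Q = {T. T \<subseteq> I \<and> tight T}"
  define P where "P = {T \<in> Q. \<forall>S\<in>Q. T \<subseteq> S \<longrightarrow> S = T}"
  have finQ: "finite Q"
    using d(2) by (auto simp: Q_def)
  have ex: "\<exists>T\<in>P. S \<subseteq> T" if "S \<in> Q" for S
    using finite_has_maximal2[OF finQ that] by (auto simp: P_def)
  have dis: "disjoint P"
  proof (rule disjointI)
    fix S T assume "S \<in> P" "T \<in> P" "S \<noteq> T"
    show "S \<inter> T = {}"
    proof (rule ccontr)
      assume "S \<inter> T \<noteq> {}"
      then have "S \<union> T \<in> Q"
        using tight_Un[OF I, of S T] \<open>S \<in> P\<close> \<open>T \<in> P\<close> by (simp add: P_def Q_def)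
      moreover have "\<forall>R\<in>Q. S \<subseteq> R \<longrightarrow> R = S" "\<forall>R\<in>Q. T \<subseteq> R \<longrightarrow> R = T"
        using \<open>S \<in> P\<close> \<open>T \<in> P\<close> by (simp_all add: P_def)
      ultimately have "S \<union> T = S" "S \<union> T = T"
        by (metis Un_upper1, metis Un_upper2)
      then show False
        using \<open>S \<noteq> T\<close> by simp
    qed
  qed
  \<comment> \<open>The normalisation of \<open>g\<close> on singletons makes them tight; this is
    why the maximal tight sets cover \<open>I\<close>.\<close>
  have sing: "{e} \<in> Q" if "e \<in> I" for e
    using that singleton[of e] d(1) by (auto simp: Q_def tight_def)
  have Un: "\<Union>P = I"
  proof
    show "\<Union>P \<subseteq> I"
      by (auto simp: P_def Q_def)
    show "I \<subseteq> \<Union>P"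
      using ex[OF sing] by blast
  qed
  have "e \<in> (\<Union>T\<in>P. cl T)" if e: "e \<in> F" for e
  proof (cases "e \<in> I")
    case True
    then obtain T where "T \<in> P" "e \<in> T"
      using Un by auto
    then show ?thesis
      using F e by (force simp: cl_def insert_absorb)
  next
    case False
    then have "insert e I \<notin> count_indep g E"
      using max e by auto
    moreover have "insert e I \<subseteq> E"
      using d(1) F e by auto
    ultimately obtain L where L: "L \<subseteq> insert e I" "L \<noteq> {}" "g L < int (card L)"
      unfolding count_indep_def mem_Collect_eq by (meson not_le)
    have "e \<in> L"
      using d(3)[of L] L by (metis not_le subset_insert)
    define L' where "L' = L - {e}"
    have L': "L' \<subseteq> I" "L = insert e L'" "e \<notin> L'" "finite L'"
      using L(1) \<open>e \<in> L\<close> d(2) finite_subset by (auto simp: L'_def)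
    have LE: "insert e L' \<subseteq> E"
      using L' d(1) F e by auto
    \<comment> \<open>If \<open>L\<close> were \<open>{e}\<close>, the violated inequality would
      read \<open>g {e} < 1\<close>.\<close>
    have "L' \<noteq> {}"
      using L(3) L' singleton[of e] e F by auto
    moreover have "int (card L') \<le> g L'"
      using d(3) L' calculation by blast
    moreover have "g L' \<le> g (insert e L')"
      using LE by (intro mono) auto
    moreover have "g (insert e L') \<le> int (card L')"
      using L(3) L' by simp
    \<comment> \<open>The chain \<open>card L'\<close> \<le> \<open>g L'\<close> \<le>
      \<open>g (insert e L')\<close> \<le> \<open>card L'\<close> collapses.\<close>
    ultimately have "tight L'" and gL: "g (insert e L') = g L'"
      by (auto simp: tight_def)
    then obtain T where T: "T \<in> P" "L' \<subseteq> T"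
      using ex[of L'] L' by (auto simp: Q_def)
    have TE: "T \<subseteq> I"
      using T by (auto simp: P_def Q_def)
    have "g (T \<union> insert e L') + g (T \<inter> insert e L') \<le> g T + g (insert e L')"
      using TE LE d(1) by (intro submodular) auto
    moreover have "T \<union> insert e L' = insert e T" "T \<inter> insert e L' = L'"
      using T TE False by auto
    moreover have "g T \<le> g (insert e T)"
      using TE d(1) F e by (intro mono) auto
    ultimately show ?thesis
      using gL T F e by (auto simp: cl_def)
  qed
  then have "F \<subseteq> (\<Union>T\<in>P. cl T)" ..
  moreover have "finite P"
    using finQ by (simp add: P_def)
  moreover have "\<And>T. T \<in> P \<Longrightarrow> tight T"
    by (simp add: P_def Q_def)
  ultimately show thesis
    using that dis Un by metis
qed

text \<open>Counting \<open>J\<close> inside each closure: \<open>J \<inter> cl T\<close> has at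
  most \<open>g (cl T)\<close> \<le> \<open>g T\<close> = \<open>card T\<close> elements, and the
  disjoint parts \<open>T\<close> add up to \<open>I\<close>.\<close>

lemma card_indep_le_maximal:
  assumes I: "I \<in> count_indep g E" "I \<subseteq> F" and F: "F \<subseteq> E"
    and max: "\<And>e. e \<in> F - I \<Longrightarrow> insert e I \<notin> count_indep g E"
    and J: "J \<in> count_indep g E" "J \<subseteq> F"
  shows "card J \<le> card I"
proof -
  obtain P where P: "finite P" "disjoint P" "\<Union>P = I" "\<And>T. T \<in> P \<Longrightarrow> tight T"
    "F \<subseteq> (\<Union>T\<in>P. cl T)"
    using maximal_indep_decomposition[OF I F max] by blast
  have sub: "T \<subseteq> I" if "T \<in> P" for T
    using P(3) that by auto
  note dI = indepD[OF I(1)]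
  have "J = (\<Union>T\<in>P. J \<inter> cl T)"
    using J P(5) by auto
  then have "int (card J) \<le> (\<Sum>T\<in>P. int (card (J \<inter> cl T)))"
    using card_UN_le[OF P(1), of "\<lambda>T. J \<inter> cl T"] by (metis of_nat_mono of_nat_sum)
  also have "\<dots> \<le> (\<Sum>T\<in>P. int (card T))"
  proof (rule sum_mono)
    fix T assume T: "T \<in> P"
    show "int (card (J \<inter> cl T)) \<le> int (card T)"
    proof (cases "J \<inter> cl T = {}")
      case False
      have "int (card (J \<inter> cl T)) \<le> g (J \<inter> cl T)"
        using indepD(3)[OF J(1)] False by auto
      also have "\<dots> \<le> g (cl T)"
        by (intro mono) (auto simp: cl_def)
      also have "\<dots> \<le> g T"
        using g_cl sub[OF T] dI(1) by blast
      finally show ?thesis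
        using P(4)[OF T] by (simp add: tight_def)
    qed simp
  qed
  also have "\<dots> = int (card I)"
  proof -
    have "card (\<Union>P) = (\<Sum>T\<in>P. card T)"
      using P(2) finite_subset[OF sub dI(2)]
      by (intro card_Union_disjoint) (auto simp: disjoint_def pairwise_def disjnt_def)
    then show ?thesis
      using P(3) by simp
  qed
  finally show ?thesis
    by simp
qed

text \<open>Augmentation is the previous bound for \<open>F = I \<union> J\<close>: if no element of
  \<open>J - I\<close> can be added, \<open>I\<close> is maximal in that union.\<close>

lemma matroid_count_indep: "matroid E (count_indep g E)"
proof
  fix I J
  assume I: "I \<in> count_indep g E" and J: "J \<in> count_indep g E" and less: "card I < card J"
  show "\<exists>x\<in>J - I. insert x I \<in> count_indep g E"
  proof (rule ccontr)
    assume "\<not> ?thesis"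
    then have "card J \<le> card I"
      using indepD(1)[OF I] indepD(1)[OF J] I J
      by (intro card_indep_le_maximal[where F = "I \<union> J"]) auto
    then show False
      using less by simp
  qed
next
  fix I J
  assume "I \<in> count_indep g E" "J \<subseteq> I"
  then show "J \<in> count_indep g E"
    unfolding count_indep_def by blast
qed (simp_all add: finite_ground count_indep_def)

end

section \<open>Proper sequences bound the rank\<close>

context matroid
begin

lemma finite_indep: "I \<in> indep \<Longrightarrow> finite I"
  using indep_subset_carrier finite_carrier finite_subset by blast

lemma extend_indep:
  assumes "I \<in> indep" "J \<in> indep"
  shows "\<exists>K\<in>indep. I \<subseteq> K \<and> K \<subseteq> I \<union> J \<and> card J \<le> card K"
  using assms(1)
proof (induction "card J - card I" arbitrary: I)
  case 0
  then show ?case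
    by auto
next
  case (Suc m)
  then obtain x where x: "x \<in> J - I" "insert x I \<in> indep"
    using augmentation[OF Suc.prems assms(2)] by (metis zero_less_Suc zero_less_diff)
  have "m = card J - card (insert x I)"
    using Suc.hyps(2) x finite_indep[OF Suc.prems] by auto
  from Suc.hyps(1)[OF this x(2)] show ?case
    using x(1) by blast
qed

lemma card_indep_le_rank: "I \<in> indep \<Longrightarrow> I \<subseteq> F \<Longrightarrow> card I \<le> rank_of indep F"
  unfolding rank_of_def
  by (intro Max_ge finite_imageI imageI finite_subset[of "{I \<in> indep. I \<subseteq> F}" "Pow carrier"])
    (auto simp: finite_carrier dest: indep_subset_carrier)

lemma rank_of_witness:
  obtains I where "I \<in> indep" "I \<subseteq> F" "card I = rank_of indep F"
proof -
  have "finite {I \<in> indep. I \<subseteq> F}"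
    by (rule finite_subset[of _ "Pow carrier"]) (use indep_subset_carrier finite_carrier in auto)
  moreover have "{} \<in> {I \<in> indep. I \<subseteq> F}"
    using empty_indep by auto
  ultimately have "rank_of indep F \<in> card ` {I \<in> indep. I \<subseteq> F}"
    unfolding rank_of_def by (intro Max_in) auto
  then show thesis
    using that by auto
qed

end

text \<open>Sequences are built and analysed at their end. The guard \<open>Xs \<noteq> []\<close>
  reflects that the first term is unconstrained; it makes a difference only for empty
  \<open>X\<close>.\<close>

lemma proper_sequence_snoc:
  "proper_sequence \<X> (Xs @ [X]) \<longleftrightarrow>
     proper_sequence \<X> Xs \<and> X \<in> \<X> \<and> (Xs \<noteq> [] \<longrightarrow> \<not> X \<subseteq> \<Union>(set Xs))"
proof -
  have eq: "(\<Union>j<i. (Xs @ [X]) ! j) = (\<Union>j<i. Xs ! j)" if "i \<le> length Xs" for i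
    using that by (intro SUP_cong) (auto simp: nth_append)
  have Un: "(\<Union>j<length Xs. Xs ! j) = \<Union>(set Xs)"
    by (metis atLeast_upt list.set_map map_nth)
  have "(\<forall>i. 1 \<le> i \<and> i < length (Xs @ [X]) \<longrightarrow> \<not> (Xs @ [X]) ! i \<subseteq> (\<Union>j<i. (Xs @ [X]) ! j)) \<longleftrightarrow>
      (\<forall>i. 1 \<le> i \<and> i < length Xs \<longrightarrow> \<not> Xs ! i \<subseteq> (\<Union>j<i. Xs ! j)) \<and>
      (1 \<le> length Xs \<longrightarrow> \<not> X \<subseteq> (\<Union>j<length Xs. Xs ! j))" (is "?L \<longleftrightarrow> ?R1 \<and> ?R2")
  proof
    assume L: ?L
    have ?R1
    proof (intro allI impI)
      fix i assume "1 \<le> i \<and> i < length Xs"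
      then show "\<not> Xs ! i \<subseteq> (\<Union>j<i. Xs ! j)"
        using L[rule_format, of i] eq[of i] by (simp add: nth_append)
    qed
    moreover have ?R2
      using L[rule_format, of "length Xs"] eq[of "length Xs"] by (simp add: nth_append)
    ultimately show "?R1 \<and> ?R2" ..
  next
    assume R: "?R1 \<and> ?R2"
    show ?L
    proof (intro allI impI)
      fix i assume i: "1 \<le> i \<and> i < length (Xs @ [X])"
      show "\<not> (Xs @ [X]) ! i \<subseteq> (\<Union>j<i. (Xs @ [X]) ! j)"
      proof (cases "i = length Xs")
        case True
        then show ?thesis
          using R i eq[of i] by (simp add: nth_append)
      next
        case False
        then show ?thesis
          using R i eq[of i] by (simp add: nth_append)
      qed
    qed
  qed
  then show ?thesis
    unfolding proper_sequence_def Un by (auto simp: Suc_le_eq)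
qed

text \<open>Let \<open>D\<close> be the union of the earlier terms. A new term \<open>X\<close> is a
  circuit with some element outside \<open>D\<close>, so it raises the rank by at most |X - D| - 1.
  Elements of \<open>F\<close> outside all terms raise it by at most one each.\<close>

lemma (in matroid) card_indep_le_val_seq:
  assumes circ: "\<And>X. X \<in> \<X> \<Longrightarrow> circuit carrier indep X"
    and S: "proper_sequence \<X> Xs" and F: "F \<subseteq> carrier" and J: "J \<in> indep" "J \<subseteq> F"
  shows "int (card J) \<le> val_seq F Xs"
proof -
  have base: "int (card J) \<le> int (card (\<Union>(set Xs))) - int (length Xs)"
    if "J \<in> indep" "J \<subseteq> \<Union>(set Xs)" for J
    using S that
  proof (induction Xs arbitrary: J rule: rev_induct)
    case (snoc X Xs)
    let ?D = "\<Union>(set Xs)"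
    have S': "proper_sequence \<X> Xs" "X \<in> \<X>" "Xs \<noteq> [] \<Longrightarrow> \<not> X \<subseteq> ?D"
      using snoc.prems(1) by (auto simp: proper_sequence_snoc)
    have C: "X \<subseteq> carrier" "X \<notin> indep" "\<And>D. D \<subset> X \<Longrightarrow> D \<in> indep"
      using circ[OF S'(2)] by (auto simp: circuit_def)
    \<comment> \<open>For the first term \<open>?D\<close> is empty, and a circuit is not empty
      because the empty set is independent.\<close>
    have "\<not> X \<subseteq> ?D"
      using S'(3) C(2) empty_indep by (cases Xs) auto
    then obtain e where e: "e \<in> X" "e \<notin> ?D"
      by auto
    have "?D \<subseteq> carrier"
      using S'(1) circ by (fastforce simp: proper_sequence_def circuit_def)
    then have fin: "finite ?D" "finite X"
      using C(1) finite_carrier finite_subset by blast+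
    have "X - {e} \<in> indep"
      using C(3) e(1) by blast
    \<comment> \<open>\<open>K\<close> replaces \<open>J\<close> by a set at least as large that
      contains \<open>X - {e}\<close>. Being independent it avoids \<open>e\<close>, so outside
      \<open>?D\<close> it has at most |X - D| - 1 elements.\<close>
    then obtain K where K: "K \<in> indep" "X - {e} \<subseteq> K" "K \<subseteq> (X - {e}) \<union> J" "card J \<le> card K"
      using extend_indep[OF _ snoc.prems(2)] by blast
    have eK: "e \<notin> K"
      using K(1,2) C(2) indep_subset e(1) by blast
    have KD: "K \<inter> ?D \<in> indep"
      using K(1) indep_subset by blast
    have "K \<subseteq> (K \<inter> ?D) \<union> (X - ?D - {e})"
      using K(3) snoc.prems(3) eK by auto
    then have "card K \<le> card (K \<inter> ?D) + card (X - ?D - {e})"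
      using card_mono[of "(K \<inter> ?D) \<union> (X - ?D - {e})" K] card_Un_le[of "K \<inter> ?D" "X - ?D - {e}"] fin
      by fastforce
    moreover have "int (card (K \<inter> ?D)) \<le> int (card ?D) - int (length Xs)"
      using snoc.IH[OF S'(1) KD] by auto
    moreover have "int (card (X - ?D - {e})) = int (card (X - ?D)) - 1"
      using card_Suc_Diff1[of "X - ?D" e] e fin by simp
    moreover have "card (\<Union>(set (Xs @ [X]))) = card ?D + card (X - ?D)"
      using fin card_Un_disjoint[of ?D "X - ?D"] by (simp add: Un_commute Un_Diff_cancel2 Int_Diff)
    ultimately show ?case
      using K(4) by simp
  qed simp
  let ?D = "\<Union>(set Xs)"
  have "?D \<subseteq> carrier"
    using S circ by (fastforce simp: proper_sequence_def circuit_def)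
  then have fin: "finite ?D" "finite F"
    using F finite_carrier finite_subset by blast+
  have "J \<subseteq> (J \<inter> ?D) \<union> (F - ?D)"
    using J by auto
  then have "card J \<le> card (J \<inter> ?D) + card (F - ?D)"
    using card_mono[of "(J \<inter> ?D) \<union> (F - ?D)" J] card_Un_le[of "J \<inter> ?D" "F - ?D"] fin
    by fastforce
  moreover have "int (card (J \<inter> ?D)) \<le> int (card ?D) - int (length Xs)"
    using base[of "J \<inter> ?D"] indep_subset[OF J(1)] by blast
  moreover have "card (F \<union> ?D) = card ?D + card (F - ?D)"
    using fin card_Un_disjoint[of ?D "F - ?D"] by (simp add: Un_commute Un_Diff_cancel2 Int_Diff)
  ultimately show ?thesis
    by (simp add: val_seq_def)
qed

text \<open>The bound \<open>upper\<close> holds in every matroid of the family and is attained in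
  \<open>\<I>\<close>. Hence a set \<open>J\<close> independent in any of them has at most
  \<open>rank_of \<I> J\<close> elements, that is, \<open>J\<close> lies in \<open>\<I>\<close>:
  this matroid is the greatest one, not merely a maximal one.\<close>

lemma unique_maximal_and_rank_eq_val:
  assumes M: "H_matroid \<H> n \<I>"
    and seq: "\<And>F. F \<subseteq> snd (complete_graph n) \<Longrightarrow>
      \<exists>I\<in>\<I>. I \<subseteq> F \<and> (\<exists>Xs. proper_sequence (copies \<H> n) Xs \<and> val_seq F Xs \<le> int (card I))"
  shows "unique_maximal_H_matroid \<H> n \<I> \<and>
    (\<forall>F. F \<subseteq> snd (complete_graph n) \<longrightarrow> int (rank_of \<I> F) = val_H \<H> n F)"
proof -
  let ?E = "snd (complete_graph n)"
  have upper: "int (card J) \<le> val_H \<H> n F" if "H_matroid \<H> n \<J>" "J \<in> \<J>" "J \<subseteq> F" "F \<subseteq> ?E" for \<J> J F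
  proof -
    interpret matroid ?E \<J>
      using that by (simp add: H_matroid_def)
    show ?thesis
      unfolding val_H_def
      using that card_indep_le_val_seq[of "copies \<H> n"] finite_proper_sequences[OF finite_copies, of \<H> n]
      by (subst Min_ge_iff) (auto simp: H_matroid_def intro: proper_sequence_Nil)
  qed
  interpret M: matroid ?E \<I>
    using M by (simp add: H_matroid_def)
  have rank: "int (rank_of \<I> F) = val_H \<H> n F" if F: "F \<subseteq> ?E" for F
  proof (rule antisym)
    obtain I where "I \<in> \<I>" "I \<subseteq> F" "card I = rank_of \<I> F"
      using M.rank_of_witness by blast
    then show "int (rank_of \<I> F) \<le> val_H \<H> n F"
      using upper[OF M] F by metis
    obtain I Xs where I: "I \<in> \<I>" "I \<subseteq> F" "proper_sequence (copies \<H> n) Xs" "val_seq F Xs \<le> int (card I)"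
      using seq[OF F] by blast
    have "val_H \<H> n F \<le> val_seq F Xs"
      unfolding val_H_def using I finite_proper_sequences[OF finite_copies, of \<H> n]
      by (intro Min_le) auto
    then show "val_H \<H> n F \<le> int (rank_of \<I> F)"
      using I M.card_indep_le_rank[of I F] by simp
  qed
  have le: "weak_le \<J> \<I>" if J: "H_matroid \<H> n \<J>" for \<J>
    unfolding weak_le_def
  proof (rule ballI)
    fix J assume "J \<in> \<J>"
    moreover have JE: "J \<subseteq> ?E"
      using J \<open>J \<in> \<J>\<close> matroid.indep_subset_carrier by (auto simp: H_matroid_def)
    ultimately have "card J \<le> rank_of \<I> J"
      using upper[OF J, of J J] rank[of J] by simp
    moreover obtain I where "I \<in> \<I>" "I \<subseteq> J" "card I = rank_of \<I> J"
      using M.rank_of_witness by blast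
    moreover have "finite J"
      using JE M.finite_carrier finite_subset by blast
    ultimately show "J \<in> \<I>"
      using card_seteq[of J I] by simp
  qed
  have "maximal_H_matroid \<H> n \<I>"
    using M le by (auto simp: maximal_H_matroid_def weak_le_def)
  moreover have "\<J> = \<I>" if "maximal_H_matroid \<H> n \<J>" for \<J>
    using that le M unfolding maximal_H_matroid_def by metis
  ultimately show ?thesis
    using rank unfolding unique_maximal_H_matroid_def by blast
qed

section \<open>Completing circuits one edge at a time\<close>

text \<open>Certificates that \<open>D\<close> has rank at most \<open>r\<close> whenever the
  members of \<open>\<X>\<close> are circuits: \<open>r\<close> bounds the number of free additions.
  Neither \<open>free\<close> nor \<open>completed\<close> asks \<open>e\<close> to be new, so
  derivations can be overlaid, and \<open>weaken\<close> absorbs small cases where the charge is not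
  sharp.\<close>

inductive spans :: "'a set set \<Rightarrow> 'a set \<Rightarrow> nat \<Rightarrow> bool" for \<X> where
  empty: "spans \<X> {} 0"
| free: "spans \<X> D r \<Longrightarrow> spans \<X> (insert e D) (Suc r)"
| completed: "spans \<X> D r \<Longrightarrow> X \<in> \<X> \<Longrightarrow> e \<in> X \<Longrightarrow> X \<subseteq> insert e D \<Longrightarrow> spans \<X> (insert e D) r"
| weaken: "spans \<X> D r \<Longrightarrow> r \<le> s \<Longrightarrow> spans \<X> D s"

text \<open>A completed new edge lies in no earlier term, as those are contained in
  \<open>D\<close>; so appending \<open>X\<close> keeps the sequence proper. Completions add one
  edge and one term, hence \<open>card D\<close> minus the length grows only at free
  additions.\<close>

lemma spans_imp_proper_sequence:
  assumes "spans \<X> D r"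
  shows "finite D \<and> (\<exists>Xs. proper_sequence \<X> Xs \<and> \<Union>(set Xs) \<subseteq> D \<and> card D \<le> r + length Xs)"
  using assms
proof induction
  case empty
  then show ?case
    using proper_sequence_Nil by fastforce
next
  case (free D r e)
  then show ?case
    by (fastforce simp: card_insert_if)
next
  case (completed D r X e)
  show ?case
  proof (cases "e \<in> D")
    \<comment> \<open>The set does not change and \<open>X\<close> may already be covered, so no
      term is appended.\<close>
    case True
    then show ?thesis
      using completed.IH by (simp add: insert_absorb)
  next
    case False
    obtain Xs where Xs: "proper_sequence \<X> Xs" "\<Union>(set Xs) \<subseteq> D" "card D \<le> r + length Xs"
      using completed.IH by blast
    then have "proper_sequence \<X> (Xs @ [X])"
      using False completed.hyps unfolding proper_sequence_snoc by blast
    moreover have "\<Union>(set (Xs @ [X])) \<subseteq> insert e D"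
      using Xs completed.hyps by auto
    ultimately show ?thesis
      using Xs False completed.IH by (intro conjI exI[of _ "Xs @ [X]"]) auto
  qed
next
  case (weaken D r s)
  then show ?case
    by (meson add_le_mono1 le_trans)
qed

lemma spans_imp_val_seq_le:
  assumes "spans \<X> D r" "F \<subseteq> D"
  shows "\<exists>Xs. proper_sequence \<X> Xs \<and> val_seq F Xs \<le> int r"
proof -
  obtain Xs where Xs: "finite D" "proper_sequence \<X> Xs" "\<Union>(set Xs) \<subseteq> D" "card D \<le> r + length Xs"
    using spans_imp_proper_sequence[OF assms(1)] by blast
  have "card (F \<union> \<Union>(set Xs)) \<le> card D"
    using Xs assms(2) by (intro card_mono) auto
  then show ?thesis
    using Xs by (auto simp: val_seq_def)
qed

text \<open>The second derivation is replayed on top of \<open>D\<close>.\<close>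

lemma spans_Un:
  assumes "spans \<X> D r" "spans \<X> D' r'"
  shows "spans \<X> (D \<union> D') (r + r')"
  using assms(2)
proof induction
  case (completed D' r' X e)
  then show ?case
    using spans.completed[of \<X> "D \<union> D'" "r + r'" X e] by auto
next
  case (weaken D' r' s)
  then show ?case
    using spans.weaken[of \<X> "D \<union> D'" "r + r'" "r + s"] by simp
qed (use assms(1) in \<open>auto intro: spans.intros\<close>)

lemma spans_free:
  assumes "finite D"
  shows "spans \<X> D (card D)"
  using assms by (induction D) (auto intro: spans.intros)

text \<open>The pattern for attaching a vertex: \<open>S0\<close> holds its free edges and
  \<open>S\<close> all its edges. Each remaining edge is completed from \<open>D \<union> S0\<close>
  alone, so their order is irrelevant.\<close>

lemma spans_extend:
  assumes D: "spans \<X> D r" and fin: "finite S0" "finite S"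
    and compl: "\<And>e. e \<in> S - S0 \<Longrightarrow> \<exists>X\<in>\<X>. e \<in> X \<and> X \<subseteq> insert e (D \<union> S0)"
  shows "spans \<X> (D \<union> S0 \<union> S) (r + card S0)"
  using fin(2) compl
proof (induction S)
  case empty
  then show ?case
    using spans_Un[OF D spans_free[OF fin(1)]] by simp
next
  case (insert e S)
  have IH: "spans \<X> (D \<union> S0 \<union> S) (r + card S0)"
    using insert.prems by (intro insert.IH) auto
  show ?case
  proof (cases "e \<in> S0")
    case True
    then show ?thesis
      using IH by (simp add: insert_absorb)
  next
    case False
    then obtain X where "X \<in> \<X>" "e \<in> X" "X \<subseteq> insert e (D \<union> S0)"
      using insert.prems by blast
    then show ?thesis
      using spans.completed[OF IH, of X e] by auto
  qed
qed

lemma spans_UN: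
  assumes "finite P" "\<And>T. T \<in> P \<Longrightarrow> spans \<X> (K T) (r T)"
  shows "spans \<X> (\<Union>T\<in>P. K T) (\<Sum>T\<in>P. r T)"
  using assms by (induction P) (auto intro: spans.empty spans_Un)

text \<open>Reduces the problem to single tight sets: derivations for the closures of the parts are
  joined, and since the parts are disjoint their charges sum to \<open>card I\<close>.\<close>

lemma (in count_function) spanning_sequence_exists:
  assumes span: "\<And>T. T \<in> count_indep g E \<Longrightarrow> tight T \<Longrightarrow> \<exists>K. cl T \<subseteq> K \<and> spans \<X> K (card T)"
    and F: "F \<subseteq> E"
  shows "\<exists>I\<in>count_indep g E. I \<subseteq> F \<and> (\<exists>Xs. proper_sequence \<X> Xs \<and> val_seq F Xs \<le> int (card I))"
proof -
  let ?S = "{I \<in> count_indep g E. I \<subseteq> F}"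
  have "finite ?S"
    by (rule finite_subset[of _ "Pow E"]) (use finite_ground F in auto)
  moreover have "{} \<in> ?S"
    by (simp add: count_indep_def)
  ultimately obtain I where I: "I \<in> ?S" and max: "\<And>J. J \<in> ?S \<Longrightarrow> I \<subseteq> J \<Longrightarrow> I = J"
    using finite_has_maximal[of ?S] by auto
  have "insert e I \<notin> count_indep g E" if "e \<in> F - I" for e
    using max[of "insert e I"] I that by auto
  then obtain P where P: "finite P" "disjoint P" "\<Union>P = I" "\<And>T. T \<in> P \<Longrightarrow> tight T"
    "F \<subseteq> (\<Union>T\<in>P. cl T)"
    using maximal_indep_decomposition[of I F] I F by (metis (lifting) mem_Collect_eq)
  have T: "T \<in> count_indep g E" if "T \<in> P" for T
    using matroid.indep_subset[OF matroid_count_indep, of I T] that P(3) I by auto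
  obtain K where K: "\<And>T. T \<in> P \<Longrightarrow> cl T \<subseteq> K T \<and> spans \<X> (K T) (card T)"
    using span[OF T P(4)] by metis
  have "spans \<X> (\<Union>T\<in>P. K T) (\<Sum>T\<in>P. card T)"
    using K by (intro spans_UN P(1)) auto
  moreover have "(\<Sum>T\<in>P. card T) = card I"
    using card_Union_disjoint[of P] P indepD(2)[OF T]
    by (simp add: disjoint_def pairwise_def disjnt_def)
  moreover have "F \<subseteq> (\<Union>T\<in>P. K T)"
    using P(5) K by blast
  ultimately show ?thesis
    using spans_imp_val_seq_le[of \<X> "\<Union>T\<in>P. K T" "card I" F] I by auto
qed

section \<open>The rank function of the even cycle matroid\<close>

text \<open>The rank function of the signed-graphic matroid in which every edge is negative: there
  the balanced components are the bipartite ones.\<close>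

definition even_rank :: "'a set set \<Rightarrow> int" where
  "even_rank F = int (card (\<Union>F)) - int (beta F)"

text \<open>The kernel of the unsigned incidence matrix over the integers modulo 3. A common vertex
  set \<open>V\<close>, with zero labels outside, places the kernels of different edge sets in one
  finite space.\<close>

definition antisymmetric_labellings :: "'a set \<Rightarrow> 'a set set \<Rightarrow> ('a \<Rightarrow> 3) set" where
  "antisymmetric_labellings V F =
     {x. (\<forall>v. v \<notin> V \<longrightarrow> x v = 0) \<and> (\<forall>u v. {u, v} \<in> F \<longrightarrow> x u + x v = 0)}"

lemma cases_3: "(x :: 3) = 0 \<or> x = 1 \<or> x = - 1"
proof (cases x rule: bit1.cases)
  case (1 z)
  then have "z = 0 \<or> z = 1 \<or> z = 2"
    by auto
  then show ?thesis
    using 1 by auto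
qed

section \<open>Connected components as equivalence classes\<close>

lemma connected_rel_refl: "(v, v) \<in> connected_rel F"
  by (simp add: connected_rel_def)

lemma connected_rel_sym: "(u, v) \<in> connected_rel F \<Longrightarrow> (v, u) \<in> connected_rel F"
  unfolding connected_rel_def
  by (rule symD[OF sym_rtrancl]) (auto simp: sym_def insert_commute)

lemma connected_rel_trans:
  "(u, v) \<in> connected_rel F \<Longrightarrow> (v, w) \<in> connected_rel F \<Longrightarrow> (u, w) \<in> connected_rel F"
  unfolding connected_rel_def by simp

lemma connected_rel_edge: "{u, v} \<in> F \<Longrightarrow> (u, v) \<in> connected_rel F"
  unfolding connected_rel_def by auto

lemma connected_rel_class_eq:
  "connected_rel F `` {u} = connected_rel F `` {v} \<longleftrightarrow> (u, v) \<in> connected_rel F"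
  using connected_rel_sym connected_rel_trans connected_rel_refl by fast

text \<open>\<open>connected_rel\<close> is reflexive on the whole type, so vertices without edges
  form singleton classes. In the dimension count they are the isolated vertices of
  \<open>V\<close>.\<close>

lemma connected_rel_outside:
  assumes "(u, v) \<in> connected_rel F" "u \<notin> \<Union>F"
  shows "v = u"
  using assms unfolding connected_rel_def by (induction rule: rtrancl_induct) auto

lemma connected_rel_in_Union:
  assumes "(u, v) \<in> connected_rel F" "u \<in> \<Union>F"
  shows "v \<in> \<Union>F"
  using assms unfolding connected_rel_def by (induction rule: rtrancl_induct) auto

lemma components_eq: "components F = (\<lambda>v. connected_rel F `` {v}) ` \<Union>F"
  by (auto simp: components_def incident_vertices_def quotient_def)

lemma Union_components: "\<Union>(components F) = \<Union>F"
  unfolding components_eq using connected_rel_refl connected_rel_in_Union by fastforce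

lemma componentD:
  assumes "C \<in> components F" "v \<in> C"
  shows "C = connected_rel F `` {v}"
proof -
  obtain w where "C = connected_rel F `` {w}"
    using assms by (auto simp: components_eq)
  then show ?thesis
    using assms connected_rel_class_eq[of F w v] by simp
qed

lemma disjoint_components: "disjoint (components F)"
proof (rule disjointI)
  fix C D assume "C \<in> components F" "D \<in> components F" "C \<noteq> D"
  then show "C \<inter> D = {}"
    using componentD[of C F] componentD[of D F] by (metis disjoint_iff)
qed

lemma edge_in_component:
  assumes "F \<subseteq> all_edges V" "e \<in> F" "C \<in> components F" "e \<inter> C \<noteq> {}"
  shows "e \<subseteq> C"
proof -
  have "card e = 2"
    using assms by (auto simp: all_edges_def)
  then obtain u v where "e = {u, v}"
    by (auto simp: card_2_iff)
  then show ?thesis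
    using assms connected_rel_edge[of u v F] connected_rel_edge[of v u F] componentD[OF assms(3)]
    by (auto simp: insert_commute)
qed

lemma obtain_edge:
  assumes "e \<in> all_edges V"
  obtains u v where "e = {u, v}" "u \<noteq> v" "u \<in> V" "v \<in> V"
  using assms by (auto simp: all_edges_def card_2_iff)

lemma Union_all_edges: "F \<subseteq> all_edges V \<Longrightarrow> \<Union>F \<subseteq> V"
  by (auto simp: all_edges_def)

lemma finite_all_edges: "finite V \<Longrightarrow> finite (all_edges V)"
  by (rule finite_subset[of _ "Pow V"]) (auto simp: all_edges_def)

section \<open>Bipartite components and their two-colourings\<close>

definition bip_edges :: "'a set \<Rightarrow> 'a set \<Rightarrow> 'a set set" where
  "bip_edges A B = {{a, b} | a b. a \<in> A \<and> b \<in> B}"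

lemma bipartite_iff: "bipartite (C, S) \<longleftrightarrow> (\<exists>A\<subseteq>C. S \<subseteq> bip_edges A (C - A))"
proof
  assume "bipartite (C, S)"
  then obtain A B where "A \<union> B = C" "A \<inter> B = {}" "\<forall>e\<in>S. \<exists>a\<in>A. \<exists>b\<in>B. e = {a, b}"
    by (auto simp: bipartite_def)
  then have "A \<subseteq> C" "B = C - A" "S \<subseteq> bip_edges A B"
    unfolding bip_edges_def by blast+
  then show "\<exists>A\<subseteq>C. S \<subseteq> bip_edges A (C - A)"
    by blast
next
  assume "\<exists>A\<subseteq>C. S \<subseteq> bip_edges A (C - A)"
  then obtain A where "A \<subseteq> C" "S \<subseteq> bip_edges A (C - A)"
    by blast
  then have "A \<union> (C - A) = C \<and> A \<inter> (C - A) = {} \<and> (\<forall>e\<in>S. \<exists>a\<in>A. \<exists>b\<in>C - A. e = {a, b})"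
    unfolding bip_edges_def by blast
  then show "bipartite (C, S)"
    unfolding bipartite_def fst_conv snd_conv by blast
qed

text \<open>One colour class, fixed by choice; meaningful only when \<open>C\<close> induces a
  bipartite graph.\<close>

definition side :: "'a set set \<Rightarrow> 'a set \<Rightarrow> 'a set" where
  "side F C = (SOME A. A \<subseteq> C \<and> {e \<in> F. e \<subseteq> C} \<subseteq> bip_edges A (C - A))"

definition bip_components :: "'a set set \<Rightarrow> 'a set set" where
  "bip_components F = {C \<in> components F. bipartite (C, {e \<in> F. e \<subseteq> C})}"

lemma beta_eq: "beta F = card (bip_components F)"
  by (simp add: beta_def bip_components_def)

lemma side:
  assumes "bipartite (C, {e \<in> F. e \<subseteq> C})"
  shows "side F C \<subseteq> C" "{e \<in> F. e \<subseteq> C} \<subseteq> bip_edges (side F C) (C - side F C)"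
  using assms someI_ex[of "\<lambda>A. A \<subseteq> C \<and> {e \<in> F. e \<subseteq> C} \<subseteq> bip_edges A (C - A)"]
  unfolding bipartite_iff side_def by blast+

text \<open>The two-colouring as signs. Multiplying by it turns antisymmetric labels on a bipartite
  component into constant ones.\<close>

definition side_sign :: "'a set set \<Rightarrow> 'a \<Rightarrow> 3" where
  "side_sign F v = (if v \<in> side F (connected_rel F `` {v}) then 1 else - 1)"

lemma side_sign_sq: "side_sign F v * side_sign F v = 1"
  by (simp add: side_sign_def)

lemma side_sign_edge:
  assumes e: "{u, v} \<in> F" and bip: "bipartite (connected_rel F `` {u}, {e \<in> F. e \<subseteq> connected_rel F `` {u}})"
  shows "side_sign F v = - side_sign F u"
proof -
  let ?C = "connected_rel F `` {u}"
  have C: "connected_rel F `` {v} = ?C"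
    using connected_rel_edge[OF e] connected_rel_class_eq[of F u v] by simp
  have "{u, v} \<subseteq> ?C"
    using connected_rel_edge[OF e] connected_rel_refl by auto
  then have "{u, v} \<in> bip_edges (side F ?C) (?C - side F ?C)"
    using side(2)[OF bip] e by auto
  then have "u \<in> side F ?C \<longleftrightarrow> v \<notin> side F ?C"
    by (auto simp: bip_edges_def doubleton_eq_iff)
  then show ?thesis
    by (auto simp: side_sign_def C)
qed

section \<open>The dimension of the space of labellings\<close>

lemma labelling_connected:
  assumes "x \<in> antisymmetric_labellings V F" "(u, v) \<in> connected_rel F"
  shows "x v = x u \<or> x v = - x u"
  using assms(2) unfolding connected_rel_def
proof (induction rule: rtrancl_induct)
  case (step v w)
  then have "x v + x w = 0"
    using assms(1) by (auto simp: antisymmetric_labellings_def)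
  then show ?case
    using step.IH by (auto simp: add_eq_0_iff)
qed simp

text \<open>A nonzero label spreads along paths to the whole component, and labels +1 and -1 that
  alternate along edges would two-colour it.\<close>

lemma labelling_nonbipartite:
  assumes x: "x \<in> antisymmetric_labellings V F" and F: "F \<subseteq> all_edges V"
    and nb: "\<not> bipartite (connected_rel F `` {u}, {e \<in> F. e \<subseteq> connected_rel F `` {u}})"
  shows "x u = 0"
proof (rule ccontr)
  assume u: "x u \<noteq> 0"
  let ?C = "connected_rel F `` {u}"
  let ?A = "{v \<in> ?C. x v = 1}"
  have ne: "x v \<noteq> 0" if "v \<in> ?C" for v
    using labelling_connected[OF x, of u v] that u by auto
  have "e \<in> bip_edges ?A (?C - ?A)" if e: "e \<in> F" "e \<subseteq> ?C" for e
  proof -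
    obtain a b where ab: "e = {a, b}"
      using obtain_edge e F by blast
    have "x a + x b = 0"
      using x e ab by (auto simp: antisymmetric_labellings_def)
    moreover have "x a \<noteq> 0" "x b \<noteq> 0"
      using ne e ab by auto
    ultimately have "x a = 1 \<and> x b = - 1 \<or> x b = 1 \<and> x a = - 1"
      using cases_3[of "x a"] by (auto simp: add_eq_0_iff)
    then have "a \<in> ?A \<and> b \<in> ?C - ?A \<or> b \<in> ?A \<and> a \<in> ?C - ?A"
      using e ab by auto
    then show ?thesis
      unfolding bip_edges_def ab by (auto simp: insert_commute)
  qed
  then have "{e \<in> F. e \<subseteq> ?C} \<subseteq> bip_edges ?A (?C - ?A)"
    by blast
  then show False
    using nb unfolding bipartite_iff by (metis (no_types, lifting) mem_Collect_eq subsetI)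
qed

lemma labelling_side_sign:
  assumes x: "x \<in> antisymmetric_labellings V F" and uv: "(u, v) \<in> connected_rel F"
    and bip: "bipartite (connected_rel F `` {u}, {e \<in> F. e \<subseteq> connected_rel F `` {u}})"
  shows "side_sign F v * x v = side_sign F u * x u"
  using uv unfolding connected_rel_def
proof (induction rule: rtrancl_induct)
  case (step v w)
  then have e: "{v, w} \<in> F" and "(u, v) \<in> connected_rel F"
    by (auto simp: connected_rel_def)
  then have "connected_rel F `` {v} = connected_rel F `` {u}"
    using connected_rel_class_eq[of F u v] by simp
  then have "side_sign F w = - side_sign F v"
    using side_sign_edge[OF e] bip by simp
  moreover have "x w = - x v"
    using x e by (auto simp: antisymmetric_labellings_def add_eq_0_iff)
  ultimately show ?case
    using step.IH by simp
qed simp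

text \<open>A labelling vanishes on nonbipartite classes and is one scalar times
  \<open>side_sign\<close> on each bipartite class, so the dimension is the number of bipartite
  classes: \<open>beta F\<close> plus the number of vertices of \<open>V\<close> without edges.
  Naming the exponent \<open>k\<close> by an equation of integers avoids truncated
  subtraction.\<close>

theorem card_antisymmetric_labellings:
  assumes V: "finite V" and F: "F \<subseteq> all_edges V"
  shows "finite (antisymmetric_labellings V F)"
    and "int (card V) = even_rank F + int k \<Longrightarrow> card (antisymmetric_labellings V F) = 3 ^ k"
    and "even_rank F \<le> int (card V)"
proof -
  let ?c = "\<lambda>v. connected_rel F `` {v}"
  \<comment> \<open>The classes of all vertices of \<open>V\<close>, so isolated vertices contribute
    singleton classes.\<close>
  define J where "J = {C \<in> ?c ` V. bipartite (C, {e \<in> F. e \<subseteq> C})}"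
  define \<Phi> where "\<Phi> y v = (if v \<in> V \<and> ?c v \<in> J then side_sign F v * y (?c v) else 0)"
    for y :: "'a set \<Rightarrow> 3" and v
  have FV: "\<Union>F \<subseteq> V"
    using F by (rule Union_all_edges)
  have finJ: "finite J"
    using V by (simp add: J_def)
  have Jv: "?c v \<in> J \<longleftrightarrow> bipartite (?c v, {e \<in> F. e \<subseteq> ?c v})" if "v \<in> V" for v
    using that by (auto simp: J_def)
  have inj: "inj_on \<Phi> (J \<rightarrow>\<^sub>E UNIV)"
  proof (rule inj_onI)
    fix y z assume y: "y \<in> J \<rightarrow>\<^sub>E UNIV" and z: "z \<in> J \<rightarrow>\<^sub>E UNIV" and eq: "\<Phi> y = \<Phi> z"
    show "y = z"
    proof (rule PiE_ext[OF y z])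
      fix C assume C: "C \<in> J"
      then obtain v where v: "v \<in> V" "C = ?c v"
        by (auto simp: J_def)
      have "side_sign F v * \<Phi> y v = side_sign F v * \<Phi> z v"
        using eq by simp
      then show "y C = z C"
        using v C by (simp add: \<Phi>_def mult.assoc[symmetric] side_sign_sq)
    qed
  qed
  have img: "\<Phi> ` (J \<rightarrow>\<^sub>E UNIV) = antisymmetric_labellings V F"
  proof
    show "\<Phi> ` (J \<rightarrow>\<^sub>E UNIV) \<subseteq> antisymmetric_labellings V F"
    proof (rule image_subsetI)
      fix y :: "'a set \<Rightarrow> 3"
      have "\<Phi> y u + \<Phi> y v = 0" if e: "{u, v} \<in> F" for u v
      proof -
        have "?c u = ?c v"
          using connected_rel_edge[OF e] connected_rel_class_eq[of F u v] by simp
        moreover have "u \<in> V" "v \<in> V"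
          using e FV by auto
        ultimately show ?thesis
          using side_sign_edge[OF e] Jv[of u] by (simp add: \<Phi>_def)
      qed
      then show "\<Phi> y \<in> antisymmetric_labellings V F"
        by (simp add: antisymmetric_labellings_def \<Phi>_def)
    qed
    show "antisymmetric_labellings V F \<subseteq> \<Phi> ` (J \<rightarrow>\<^sub>E UNIV)"
    proof
      fix x assume x: "x \<in> antisymmetric_labellings V F"
      \<comment> \<open>The scalar of a class is read off at an arbitrary representative; by
        \<open>labelling_side_sign\<close> the choice is immaterial.\<close>
      define y where "y = restrict (\<lambda>C. side_sign F (SOME v. v \<in> C) * x (SOME v. v \<in> C)) J"
      have "\<Phi> y v = x v" for v
      proof (cases "v \<in> V \<and> ?c v \<in> J")
        case True
        have "(SOME w. w \<in> ?c v) \<in> ?c v"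
          using connected_rel_refl by (metis Image_singleton_iff someI)
        then have "side_sign F v * y (?c v) = side_sign F v * (side_sign F v * x v)"
          using True labelling_side_sign[OF x, of v "SOME w. w \<in> ?c v"] Jv[of v] by (simp add: y_def)
        then show ?thesis
          using True by (simp add: \<Phi>_def mult.assoc[symmetric] side_sign_sq)
      next
        case False
        then show ?thesis
          using x Jv labelling_nonbipartite[OF x F, of v]
          by (auto simp: \<Phi>_def antisymmetric_labellings_def)
      qed
      then have "\<Phi> y = x"
        by auto
      moreover have "y \<in> J \<rightarrow>\<^sub>E UNIV"
        by (simp add: y_def)
      ultimately show "x \<in> \<Phi> ` (J \<rightarrow>\<^sub>E UNIV)"
        by blast
    qed
  qed
  show "finite (antisymmetric_labellings V F)"
    using img finJ by (metis finite_PiE finite_code finite_imageI)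
  have card: "card (antisymmetric_labellings V F) = 3 ^ card J"
    using card_image[OF inj] img finJ by (simp add: card_PiE)
  have single: "?c v = {v}" if "v \<notin> \<Union>F" for v
    using connected_rel_outside[OF _ that] connected_rel_refl by auto
  have J: "J = bip_components F \<union> (\<lambda>v. {v}) ` (V - \<Union>F)"
  proof -
    have "J = {C \<in> ?c ` \<Union>F. bipartite (C, {e \<in> F. e \<subseteq> C})}
        \<union> {C \<in> ?c ` (V - \<Union>F). bipartite (C, {e \<in> F. e \<subseteq> C})}"
      using FV by (auto simp: J_def)
    moreover have "{C \<in> ?c ` (V - \<Union>F). bipartite (C, {e \<in> F. e \<subseteq> C})} = (\<lambda>v. {v}) ` (V - \<Union>F)"
    proof -
      have "bipartite ({v}, {e \<in> F. e \<subseteq> {v}})" if "v \<notin> \<Union>F" for v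
      proof -
        have "{e \<in> F. e \<subseteq> {v}} = {}"
          using that F by (fastforce simp: all_edges_def subset_singleton_iff)
        then show ?thesis
          unfolding bipartite_iff by blast
      qed
      then show ?thesis
        using single by (auto simp: image_iff)
    qed
    ultimately show ?thesis
      by (simp add: bip_components_def components_eq)
  qed
  have "card J = card (bip_components F) + card ((\<lambda>v. {v}) ` (V - \<Union>F))"
    unfolding J
  proof (rule card_Un_disjoint)
    show "finite (bip_components F)" "finite ((\<lambda>v. {v}) ` (V - \<Union>F))"
      using finJ J by auto
    show "bip_components F \<inter> (\<lambda>v. {v}) ` (V - \<Union>F) = {}"
      using Union_components[of F] by (auto simp: bip_components_def)
  qed
  also have "card ((\<lambda>v. {v}) ` (V - \<Union>F)) = card V - card (\<Union>F)"
    using FV V by (subst card_image) (auto simp: card_Diff_subset finite_subset)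
  finally have J_card: "int (card J) = int (card V) - even_rank F"
    using card_mono[OF V FV] by (simp add: even_rank_def beta_eq)
  show "even_rank F \<le> int (card V)"
    using J_card by simp
  show "card (antisymmetric_labellings V F) = 3 ^ k" if "int (card V) = even_rank F + int k"
    using card J_card that by simp
qed

lemma labellings_exponent:
  assumes "finite V" "F \<subseteq> all_edges V"
  obtains k where "int (card V) = even_rank F + int k" "card (antisymmetric_labellings V F) = 3 ^ k"
proof -
  have "int (card V) = even_rank F + int (nat (int (card V) - even_rank F))"
    using card_antisymmetric_labellings(3)[OF assms] by simp
  then show thesis
    using that card_antisymmetric_labellings(2)[OF assms] by blast
qed

section \<open>Monotonicity, submodularity and unit increase of the rank\<close>

lemma labellings_antimono:
  "A \<subseteq> B \<Longrightarrow> antisymmetric_labellings V B \<subseteq> antisymmetric_labellings V A"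
  by (auto simp: antisymmetric_labellings_def)

text \<open>More edges impose more equations, hence fewer labellings and a smaller exponent.\<close>

lemma even_rank_mono:
  assumes V: "finite V" and B: "B \<subseteq> all_edges V" and AB: "A \<subseteq> B"
  shows "even_rank A \<le> even_rank B"
proof -
  have A: "A \<subseteq> all_edges V"
    using AB B by auto
  obtain k where k: "int (card V) = even_rank A + int k" "card (antisymmetric_labellings V A) = 3 ^ k"
    using labellings_exponent[OF V A] .
  obtain l where l: "int (card V) = even_rank B + int l" "card (antisymmetric_labellings V B) = 3 ^ l"
    using labellings_exponent[OF V B] .
  have "(3::nat) ^ l \<le> 3 ^ k"
    using card_mono[OF card_antisymmetric_labellings(1)[OF V A] labellings_antimono[OF AB]] k l by simp
  then have "l \<le> k"
    by simp
  then show ?thesis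
    using k l by simp
qed

text \<open>The labelling \<open>x\<close> of \<open>F\<close> violates the equation of the new
  edge, so the inclusion of the two spaces is strict. All lower bounds on ranks come from such
  witnesses.\<close>

lemma even_rank_less:
  assumes V: "finite V" and F: "F \<subseteq> all_edges V" and e: "{u, v} \<in> all_edges V"
    and x: "x \<in> antisymmetric_labellings V F" "x u + x v \<noteq> 0"
  shows "even_rank F + 1 \<le> even_rank (insert {u, v} F)"
proof -
  have F': "insert {u, v} F \<subseteq> all_edges V"
    using F e by auto
  obtain k where k: "int (card V) = even_rank F + int k" "card (antisymmetric_labellings V F) = 3 ^ k"
    using labellings_exponent[OF V F] .
  obtain l where l: "int (card V) = even_rank (insert {u, v} F) + int l"
    "card (antisymmetric_labellings V (insert {u, v} F)) = 3 ^ l"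
    using labellings_exponent[OF V F'] .
  have "x \<notin> antisymmetric_labellings V (insert {u, v} F)"
    using x(2) by (auto simp: antisymmetric_labellings_def)
  then have "antisymmetric_labellings V (insert {u, v} F) \<subset> antisymmetric_labellings V F"
    using x(1) labellings_antimono[of F "insert {u, v} F" V] by blast
  then have "(3::nat) ^ l < 3 ^ k"
    using psubset_card_mono[OF card_antisymmetric_labellings(1)[OF V F]] k l by metis
  then have "l < k"
    by simp
  then show ?thesis
    using k l by simp
qed

text \<open>The labellings of \<open>A \<union> B\<close> are the intersection, and those of \<open>A \<inter> B\<close> contain the sum, of the
  groups of labellings of \<open>A\<close> and of \<open>B\<close>.\<close>

lemma even_rank_submodular:
  assumes V: "finite V" and A: "A \<subseteq> all_edges V" and B: "B \<subseteq> all_edges V"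
  shows "even_rank (A \<union> B) + even_rank (A \<inter> B) \<le> even_rank A + even_rank B"
proof -
  let ?L = "antisymmetric_labellings V"
  have U: "A \<union> B \<subseteq> all_edges V" and I: "A \<inter> B \<subseteq> all_edges V"
    using A B by auto
  note fin = card_antisymmetric_labellings(1)[OF V]
  \<comment> \<open>The fibres of addition on pairs of labellings. Each is no larger than the group
    of labellings of \<open>A \<union> B\<close>, which bounds the product of the two
    orders.\<close>
  define fib where "fib z = {p \<in> ?L A \<times> ?L B. (\<lambda>v. fst p v + snd p v) = z}" for z
  have cover: "?L A \<times> ?L B \<subseteq> (\<Union>z\<in>?L (A \<inter> B). fib z)"
  proof
    fix p assume p: "p \<in> ?L A \<times> ?L B"
    have "(\<lambda>v. fst p v + snd p v) \<in> ?L (A \<inter> B)"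
      using p by (auto simp: antisymmetric_labellings_def algebra_simps add_eq_0_iff)
    then show "p \<in> (\<Union>z\<in>?L (A \<inter> B). fib z)"
      using p by (auto simp: fib_def)
  qed
  have fib: "finite (fib z) \<and> card (fib z) \<le> card (?L (A \<union> B))" for z
  proof
    show "finite (fib z)"
      unfolding fib_def using fin A B by simp
    show "card (fib z) \<le> card (?L (A \<union> B))"
    proof (cases "fib z = {}")
      case False
      then obtain p where p: "p \<in> fib z"
        by auto
      have p_eq: "fst p v + snd p v = z v" for v
        using p by (auto simp: fib_def)
      show ?thesis
      proof (rule card_inj_on_le[of "\<lambda>q v. fst q v - fst p v"])
        show "inj_on (\<lambda>q v. fst q v - fst p v) (fib z)"
        proof (rule inj_onI)
          fix q q' assume q: "q \<in> fib z" "q' \<in> fib z"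
            and eq: "(\<lambda>v. fst q v - fst p v) = (\<lambda>v. fst q' v - fst p v)"
          have "fst q v = fst q' v" for v
            using fun_cong[OF eq, of v] by simp
          moreover have "fst q v + snd q v = fst q' v + snd q' v" for v
            using q by (simp add: fib_def) metis
          ultimately show "q = q'"
            by (auto simp: prod_eq_iff)
        qed
        show "(\<lambda>q v. fst q v - fst p v) ` fib z \<subseteq> ?L (A \<union> B)"
        proof (rule image_subsetI)
          fix q assume q: "q \<in> fib z"
          \<comment> \<open>Both pairs have the same sum, so the difference of first coordinates is
            also one of second coordinates and satisfies the equations of \<open>B\<close>
            too.\<close>
          have diff: "fst q v - fst p v = snd p v - snd q v" for v
          proof -
            have "fst q v + snd q v = fst p v + snd p v"
              using q p by (simp add: fib_def) metis
            then show ?thesis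
              by (simp add: algebra_simps)
          qed
          have "(\<lambda>v. fst q v - fst p v) \<in> ?L A"
            using q p by (auto simp: fib_def antisymmetric_labellings_def algebra_simps add_eq_0_iff)
          moreover have "(\<lambda>v. snd p v - snd q v) \<in> ?L B"
            using q p by (auto simp: fib_def antisymmetric_labellings_def algebra_simps add_eq_0_iff)
          ultimately show "(\<lambda>v. fst q v - fst p v) \<in> ?L (A \<union> B)"
            unfolding diff by (auto simp: antisymmetric_labellings_def)
        qed
      qed (rule fin[OF U])
    qed simp
  qed
  have "card (?L A) * card (?L B) = card (?L A \<times> ?L B)"
    by (simp add: card_cartesian_product)
  also have "\<dots> \<le> card (\<Union>z\<in>?L (A \<inter> B). fib z)"
    using cover fin[OF I] fib by (intro card_mono) auto
  also have "\<dots> \<le> (\<Sum>z\<in>?L (A \<inter> B). card (fib z))"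
    using fin[OF I] by (rule card_UN_le)
  also have "\<dots> \<le> (\<Sum>z\<in>?L (A \<inter> B). card (?L (A \<union> B)))"
    using fib by (intro sum_mono) auto
  also have "\<dots> = card (?L (A \<inter> B)) * card (?L (A \<union> B))"
    by simp
  finally have le: "card (?L A) * card (?L B) \<le> card (?L (A \<inter> B)) * card (?L (A \<union> B))" .
  obtain a where a: "int (card V) = even_rank A + int a" "card (?L A) = 3 ^ a"
    using labellings_exponent[OF V A] .
  obtain b where b: "int (card V) = even_rank B + int b" "card (?L B) = 3 ^ b"
    using labellings_exponent[OF V B] .
  obtain i where i: "int (card V) = even_rank (A \<inter> B) + int i" "card (?L (A \<inter> B)) = 3 ^ i"
    using labellings_exponent[OF V I] .
  obtain u where u: "int (card V) = even_rank (A \<union> B) + int u" "card (?L (A \<union> B)) = 3 ^ u"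
    using labellings_exponent[OF V U] .
  have "(3::nat) ^ (a + b) \<le> 3 ^ (i + u)"
    using le a b i u by (simp add: power_add)
  then have "a + b \<le> i + u"
    by simp
  then show ?thesis
    using a b i u by simp
qed

lemma even_rank_empty [simp]: "even_rank {} = 0"
  by (simp add: even_rank_def beta_def components_def incident_vertices_def)

lemma beta_pos_if_bipartite:
  assumes "finite F" "F \<noteq> {}" "F \<subseteq> all_edges V" "finite V" "A \<inter> B = {}" "F \<subseteq> bip_edges A B"
  shows "beta F \<ge> 1"
proof -
  have "\<Union>F \<noteq> {}" "finite (\<Union>F)"
    using assms(2,3,4,6) Union_all_edges[of F V] finite_subset
    by (fastforce simp: bip_edges_def, blast)
  then obtain v where v: "v \<in> \<Union>F"
    by auto
  let ?C = "connected_rel F `` {v}"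
  have C: "?C \<in> components F"
    using v by (auto simp: components_eq)
  have "{e \<in> F. e \<subseteq> ?C} \<subseteq> bip_edges (?C \<inter> A) (?C - ?C \<inter> A)"
  proof
    fix e assume "e \<in> {e \<in> F. e \<subseteq> ?C}"
    moreover from this obtain a b where "e = {a, b}" "a \<in> A" "b \<in> B"
      using assms(6) by (auto simp: bip_edges_def)
    ultimately show "e \<in> bip_edges (?C \<inter> A) (?C - ?C \<inter> A)"
      using assms(5) unfolding bip_edges_def by blast
  qed
  then have "bipartite (?C, {e \<in> F. e \<subseteq> ?C})"
    unfolding bipartite_iff by (intro exI[of _ "?C \<inter> A"] conjI Int_lower1)
  then have "?C \<in> bip_components F"
    using C by (simp add: bip_components_def)
  moreover have "finite (bip_components F)"
    using \<open>finite (\<Union>F)\<close> by (simp add: bip_components_def components_eq)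
  ultimately show ?thesis
    unfolding beta_eq by (metis One_nat_def Suc_leI card_gt_0_iff empty_iff)
qed

text \<open>The indicator of \<open>u\<close> is a labelling of \<open>F\<close>, since no edge of
  \<open>F\<close> meets \<open>u\<close>, but it violates the equation of the new edge.\<close>

lemma even_rank_pendant:
  assumes V: "finite V" and F: "F \<subseteq> all_edges V" and e: "{u, v} \<in> all_edges V" and u: "u \<notin> \<Union>F"
  shows "even_rank F + 1 \<le> even_rank (insert {u, v} F)"
proof (rule even_rank_less[OF V F e])
  let ?x = "\<lambda>w. if w = u then 1 else 0 :: 3"
  have uv: "u \<noteq> v" "u \<in> V"
    using e by (auto simp: all_edges_def card_2_iff doubleton_eq_iff)
  show "?x \<in> antisymmetric_labellings V F"
    using u uv by (auto simp: antisymmetric_labellings_def)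
  show "?x u + ?x v \<noteq> 0"
    using uv by auto
qed

lemma even_rank_singleton:
  assumes "finite V" "e \<in> all_edges V"
  shows "even_rank {e} = 1"
proof -
  obtain u v where e: "e = {u, v}" "u \<noteq> v"
    using obtain_edge assms(2) by blast
  have "even_rank {} + 1 \<le> even_rank {e}"
    using even_rank_pendant[OF assms(1), of "{}" u v] assms(2) e by simp
  moreover have "beta {e} \<ge> 1"
    using assms e by (intro beta_pos_if_bipartite[of _ V "{u}" "{v}"]) (auto simp: bip_edges_def)
  ultimately show ?thesis
    using e by (simp add: even_rank_def[of "{{u, v}}"])
qed

lemma even_rank_insert_le:
  assumes V: "finite V" and F: "F \<subseteq> all_edges V" and e: "e \<in> all_edges V"
  shows "even_rank (insert e F) \<le> even_rank F + 1"
proof (cases "e \<in> F")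
  case True
  then show ?thesis
    by (simp add: insert_absorb)
next
  case False
  have "even_rank ({e} \<union> F) + even_rank ({e} \<inter> F) \<le> even_rank {e} + even_rank F"
    using e by (intro even_rank_submodular[OF V _ F]) auto
  then show ?thesis
    using even_rank_singleton[OF V e] False by simp
qed

text \<open>The nonbipartite components are pooled because labels vanish on all of them: even an
  edge between two of them leaves the rank unchanged.\<close>

definition nonbip_vertices :: "'a set set \<Rightarrow> 'a set" where
  "nonbip_vertices F = \<Union>(components F - bip_components F)"

text \<open>Unchanged rank means that every labelling of \<open>F\<close> already satisfies the
  equation of \<open>e\<close>. Indicators rule out new vertices, and the colouring of a single
  bipartite component, tested on \<open>e\<close>, forces its ends onto opposite sides of that
  component.\<close>

lemma even_rank_eq_insert:
  assumes V: "finite V" and F: "F \<subseteq> all_edges V" and e: "e \<in> all_edges V"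
    and eq: "even_rank (insert e F) = even_rank F"
  shows "e \<in> all_edges (nonbip_vertices F) \<or>
    (\<exists>C\<in>bip_components F. e \<in> bip_edges (side F C) (C - side F C))"
proof -
  obtain u v where uv: "e = {u, v}" "u \<noteq> v" "u \<in> V" "v \<in> V"
    using obtain_edge e by blast
  have forced: "x u + x v = 0" if "x \<in> antisymmetric_labellings V F" for x
    using even_rank_less[OF V F _ that, of u v] e eq uv by force
  have FV: "\<Union>F \<subseteq> V"
    using F by (rule Union_all_edges)
  have inF: "u \<in> \<Union>F" "v \<in> \<Union>F"
    using even_rank_pendant[OF V F, of u v] even_rank_pendant[OF V F, of v u] e eq uv
    by (force simp: insert_commute)+
  have bip: "e \<in> bip_edges (side F C) (C - side F C)" if C: "C \<in> bip_components F" "u \<in> C \<or> v \<in> C" for C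
  proof -
    let ?A = "side F C"
    have B: "C \<in> components F" "bipartite (C, {e \<in> F. e \<subseteq> C})"
      using C by (auto simp: bip_components_def)
    note s = side[OF B(2)]
    \<comment> \<open>The two-colouring of \<open>C\<close> as +1 and -1, extended by zero; at least
      one of \<open>u\<close> and \<open>v\<close> has a nonzero label.\<close>
    define x :: "'a \<Rightarrow> 3" where "x w = (if w \<in> ?A then 1 else if w \<in> C then - 1 else 0)" for w
    have "C \<subseteq> V"
      using B(1) Union_components[of F] FV by auto
    moreover have "x a + x b = 0" if ab: "{a, b} \<in> F" for a b
    proof (cases "{a, b} \<subseteq> C")
      case True
      then have "{a, b} \<in> bip_edges ?A (C - ?A)"
        using s ab by auto
      then show ?thesis
        by (auto simp: bip_edges_def doubleton_eq_iff x_def)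
    next
      case False
      then have "a \<notin> C" "b \<notin> C"
        using edge_in_component[OF F ab B(1)] by auto
      then show ?thesis
        using s(1) by (auto simp: x_def)
    qed
    ultimately have "x \<in> antisymmetric_labellings V F"
      using s(1) by (auto simp: antisymmetric_labellings_def x_def)
    then have "x u + x v = 0"
      by (rule forced)
    then have "u \<in> ?A \<and> v \<in> C - ?A \<or> v \<in> ?A \<and> u \<in> C - ?A"
      using C(2) s(1) by (auto simp: x_def split: if_splits)
    then show ?thesis
      unfolding bip_edges_def uv by (auto simp: insert_commute)
  qed
  show ?thesis
  proof (cases "\<exists>C\<in>bip_components F. u \<in> C \<or> v \<in> C")
    case True
    then show ?thesis
      using bip by blast
  next
    case False
    then have "u \<in> nonbip_vertices F" "v \<in> nonbip_vertices F"
      using inF unfolding nonbip_vertices_def Union_components[of F, symmetric] by auto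
    then show ?thesis
      using e uv by (auto simp: all_edges_def)
  qed
qed

section \<open>Complete and complete bipartite graphs\<close>

lemma snd_complete_graph: "snd (complete_graph n) = all_edges {..<n}"
  by (simp add: complete_graph_def)

lemma all_edges_empty: "all_edges {} = {}"
  by (auto simp: all_edges_def)

lemma all_edges_insert:
  assumes "v \<notin> W"
  shows "all_edges (insert v W) = all_edges W \<union> (\<lambda>w. {v, w}) ` W"
proof
  show "all_edges (insert v W) \<subseteq> all_edges W \<union> (\<lambda>w. {v, w}) ` W"
  proof
    fix e assume "e \<in> all_edges (insert v W)"
    then obtain a b where "e = {a, b}" "a \<noteq> b" "a \<in> insert v W" "b \<in> insert v W"
      using obtain_edge by blast
    then show "e \<in> all_edges W \<union> (\<lambda>w. {v, w}) ` W"
      by (auto simp: all_edges_def insert_commute)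
  qed
  show "all_edges W \<union> (\<lambda>w. {v, w}) ` W \<subseteq> all_edges (insert v W)"
    using assms by (auto simp: all_edges_def card_2_iff)
qed

lemma all_edges_mono: "A \<subseteq> B \<Longrightarrow> all_edges A \<subseteq> all_edges B"
  by (auto simp: all_edges_def)

lemma card_all_edges: "finite W \<Longrightarrow> card (all_edges W) = card W choose 2"
  unfolding all_edges_def by (rule n_subsets)

lemma doubleton_in_all_edges: "{u, v} \<in> all_edges V \<longleftrightarrow> u \<noteq> v \<and> u \<in> V \<and> v \<in> V"
  by (auto simp: all_edges_def card_2_iff doubleton_eq_iff)

lemma bip_edges_commute: "bip_edges A B = bip_edges B A"
  by (auto simp: bip_edges_def insert_commute)

lemma bip_edges_insert: "bip_edges (insert v A) B = bip_edges A B \<union> (\<lambda>b. {v, b}) ` B"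
  by (auto simp: bip_edges_def)

lemma bip_edges_image: "bip_edges A B = (\<lambda>(a, b). {a, b}) ` (A \<times> B)"
  by (auto simp: bip_edges_def)

lemma card_bip_edges_le: "finite A \<Longrightarrow> finite B \<Longrightarrow> card (bip_edges A B) \<le> card A * card B"
  unfolding bip_edges_image card_cartesian_product[symmetric] by (intro card_image_le) simp

lemma card_bip_edges:
  assumes "A \<inter> B = {}"
  shows "card (bip_edges A B) = card A * card B"
proof -
  have "inj_on (\<lambda>(a, b). {a, b}) (A \<times> B)"
    using assms by (auto simp: inj_on_def doubleton_eq_iff)
  then show ?thesis
    unfolding bip_edges_image by (simp add: card_image card_cartesian_product)
qed

lemma finite_bip_edges: "finite A \<Longrightarrow> finite B \<Longrightarrow> finite (bip_edges A B)"
  unfolding bip_edges_image by simp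

lemma bip_edges_subset_all_edges: "A \<inter> B = {} \<Longrightarrow> A \<union> B \<subseteq> V \<Longrightarrow> bip_edges A B \<subseteq> all_edges V"
  unfolding bip_edges_def using doubleton_in_all_edges by fastforce

lemma bip_edgesI: "a \<in> A \<Longrightarrow> b \<in> B \<Longrightarrow> {a, b} \<in> bip_edges A B"
  by (auto simp: bip_edges_def)

section \<open>Copies as explicit edge sets\<close>

lemma copies_insert: "copies (insert H \<H>) n = copies {H} n \<union> copies \<H> n"
  by (auto simp: copies_def)

text \<open>Inverts the isomorphism of the definition: copies become images under embeddings of the
  fixed graph \<open>H\<close>, whose vertices are numerals that can be evaluated.\<close>

lemma copies_singleton:
  assumes H: "snd H \<subseteq> all_edges (fst H)"
  shows "X \<in> copies {H} n \<longleftrightarrow>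
    (\<exists>h. inj_on h (fst H) \<and> h ` fst H \<subseteq> {..<n} \<and> X = (\<lambda>e. h ` e) ` snd H)"
proof
  assume "X \<in> copies {H} n"
  then obtain G f where G: "subgraph G (complete_graph n)" "X = snd G"
    and f: "bij_betw f (fst G) (fst H)" "(\<lambda>e. f ` e) ` snd G = snd H"
    by (auto simp: copies_def graph_isomorphic_def)
  let ?h = "inv_into (fst G) f"
  have h: "bij_betw ?h (fst H) (fst G)"
    using f(1) by (rule bij_betw_inv_into)
  have "?h ` f ` e = e" if "e \<in> snd G" for e
  proof -
    have "e \<subseteq> fst G"
      using G that by (auto simp: subgraph_def all_edges_def)
    then show ?thesis
      using f(1) by (auto simp: bij_betw_def inv_into_image_cancel)
  qed
  then have "(\<lambda>e. ?h ` e) ` snd H = snd G"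
    unfolding f(2)[symmetric] by (force simp: image_image)
  moreover have "fst G \<subseteq> {..<n}"
    using G by (auto simp: subgraph_def complete_graph_def)
  ultimately show "\<exists>h. inj_on h (fst H) \<and> h ` fst H \<subseteq> {..<n} \<and> X = (\<lambda>e. h ` e) ` snd H"
    using h G(2) by (intro exI[of _ ?h]) (auto simp: bij_betw_def)
next
  assume "\<exists>h. inj_on h (fst H) \<and> h ` fst H \<subseteq> {..<n} \<and> X = (\<lambda>e. h ` e) ` snd H"
  then obtain h where h: "inj_on h (fst H)" "h ` fst H \<subseteq> {..<n}" "X = (\<lambda>e. h ` e) ` snd H"
    by blast
  let ?G = "(h ` fst H, X)"
  have X: "X \<subseteq> all_edges (h ` fst H)"
  proof
    fix e assume "e \<in> X"
    then obtain e' where e': "e = h ` e'" "e' \<subseteq> fst H" "card e' = 2"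
      using H h(3) by (auto simp: all_edges_def)
    then show "e \<in> all_edges (h ` fst H)"
      using card_image[OF inj_on_subset[OF h(1) e'(2)]] by (auto simp: all_edges_def)
  qed
  then have "subgraph ?G (complete_graph n)"
    using h(2) all_edges_mono[OF h(2)] by (auto simp: subgraph_def complete_graph_def)
  moreover have "graph_isomorphic ?G H"
    unfolding graph_isomorphic_def
  proof (intro exI conjI)
    show "bij_betw (inv_into (fst H) h) (fst ?G) (fst H)"
      using h(1) by (simp add: bij_betw_imageI bij_betw_inv_into)
    have "inv_into (fst H) h ` h ` e = e" if "e \<in> snd H" for e
      using H that h(1) by (intro inv_into_image_cancel) (auto simp: all_edges_def)
    then show "(\<lambda>e. inv_into (fst H) h ` e) ` snd ?G = snd H"
      unfolding h(3) by (force simp: image_image)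
  qed
  ultimately show "X \<in> copies {H} n"
    unfolding copies_def by force
qed

definition C4_edges :: "'a \<Rightarrow> 'a \<Rightarrow> 'a \<Rightarrow> 'a \<Rightarrow> 'a set set" where
  "C4_edges a b c d = {{a, b}, {b, c}, {c, d}, {d, a}}"

lemma lessThan_numerals:
  "{..<4} = {0, 1, 2, 3 :: nat}" "{..<5} = {0, 1, 2, 3, 4 :: nat}"
  by auto

lemma copies_C4:
  "X \<in> copies {C4} n \<longleftrightarrow>
    (\<exists>a b c d. distinct [a, b, c, d] \<and> {a, b, c, d} \<subseteq> {..<n} \<and> X = C4_edges a b c d)"
proof -
  have "snd C4 \<subseteq> all_edges (fst C4)"
    by (auto simp: C4_def all_edges_def)
  note iff = copies_singleton[OF this, of X n]
  show ?thesis
  proof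
    assume "X \<in> copies {C4} n"
    then obtain h where "inj_on h (fst C4)" "h ` fst C4 \<subseteq> {..<n}" "X = (\<lambda>e. h ` e) ` snd C4"
      unfolding iff by blast
    then have "distinct [h 0, h 1, h 2, h 3] \<and> {h 0, h 1, h 2, h 3} \<subseteq> {..<n} \<and> X = C4_edges (h 0) (h 1) (h 2) (h 3)"
      by (auto simp: C4_def C4_edges_def lessThan_numerals)
    then show "\<exists>a b c d. distinct [a, b, c, d] \<and> {a, b, c, d} \<subseteq> {..<n} \<and> X = C4_edges a b c d"
      by blast
  next
    assume "\<exists>a b c d. distinct [a, b, c, d] \<and> {a, b, c, d} \<subseteq> {..<n} \<and> X = C4_edges a b c d"
    then obtain a b c d where *: "distinct [a, b, c, d]" "{a, b, c, d} \<subseteq> {..<n}" "X = C4_edges a b c d"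
      by blast
    then show "X \<in> copies {C4} n"
      unfolding iff
      by (intro exI[of _ "(!) [a, b, c, d]"])
        (auto simp: C4_def C4_edges_def lessThan_numerals)
  qed
qed

lemma image_all_edges:
  assumes "inj_on h S"
  shows "(\<lambda>e. h ` e) ` all_edges S = all_edges (h ` S)"
proof
  show "(\<lambda>e. h ` e) ` all_edges S \<subseteq> all_edges (h ` S)"
    using assms by (auto simp: all_edges_def card_image inj_on_subset)
  show "all_edges (h ` S) \<subseteq> (\<lambda>e. h ` e) ` all_edges S"
  proof
    fix e assume "e \<in> all_edges (h ` S)"
    then obtain u v where "e = {h u, h v}" "h u \<noteq> h v" "u \<in> S" "v \<in> S"
      by (elim obtain_edge) auto
    then have "e = h ` {u, v}" "{u, v} \<in> all_edges S"
      by (auto simp: doubleton_in_all_edges)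
    then show "e \<in> (\<lambda>e. h ` e) ` all_edges S"
      by blast
  qed
qed

lemma image_all_edges_Diff:
  assumes h: "inj_on h S" and uv: "u \<in> S" "v \<in> S"
  shows "(\<lambda>e. h ` e) ` (all_edges S - {{u, v}}) = all_edges (h ` S) - {{h u, h v}}"
proof -
  have "inj_on (\<lambda>e. h ` e) (Pow S)"
    using h by (rule inj_on_image_Pow)
  then have "(\<lambda>e. h ` e) ` (all_edges S - {{u, v}}) =
      (\<lambda>e. h ` e) ` all_edges S - (\<lambda>e. h ` e) ` {{u, v}}"
    using uv by (intro inj_on_image_set_diff) (auto simp: all_edges_def)
  then show ?thesis
    using image_all_edges[OF h] by simp
qed

text \<open>Enumerates \<open>W\<close> with \<open>a\<close> and \<open>b\<close> at positions 0
  and 1, so that list indexing embeds \<open>K5_minus\<close> with its missing edge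
  \<open>{0, 1}\<close> at \<open>{a, b}\<close>.\<close>

lemma card_Diff_doubleton_list:
  assumes "card W = k + 2" "a \<in> W" "b \<in> W" "a \<noteq> b"
  obtains xs where "distinct (a # b # xs)" "set (a # b # xs) = W" "length xs = k"
proof -
  have fin: "finite W"
    using assms(1) by (metis add_2_eq_Suc' card.infinite old.nat.distinct(1))
  then obtain xs where "set xs = W - {a, b}" "distinct xs"
    by (meson finite_Diff finite_distinct_list)
  moreover have "card (W - {a, b}) = k"
    using assms fin by (subst card_Diff_subset) auto
  ultimately show thesis
    using that[of xs] assms distinct_card[of xs] by auto
qed

lemma copies_K5_minus:
  "X \<in> copies {K5_minus} n \<longleftrightarrow>
    (\<exists>W a b. card W = 5 \<and> W \<subseteq> {..<n} \<and> a \<in> W \<and> b \<in> W \<and> a \<noteq> b \<and> X = all_edges W - {{a, b}})"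
    (is "_ \<longleftrightarrow> ?R")
proof -
  have "snd K5_minus \<subseteq> all_edges (fst K5_minus)"
    by (auto simp: K5_minus_def)
  note iff = copies_singleton[OF this, of X n]
  have img: "(\<lambda>e. h ` e) ` snd K5_minus = all_edges (h ` {..<5}) - {{h 0, h 1}}"
    if "inj_on h {..<5}" for h :: "nat \<Rightarrow> nat"
    using image_all_edges_Diff[OF that, of 0 1] by (simp add: K5_minus_def)
  show ?thesis
  proof
    assume "X \<in> copies {K5_minus} n"
    then obtain h where h: "inj_on h {..<5}" "h ` {..<5} \<subseteq> {..<n}" "X = (\<lambda>e. h ` e) ` snd K5_minus"
      unfolding iff by (auto simp: K5_minus_def)
    moreover have "h 0 \<noteq> h 1"
      using inj_on_eq_iff[OF h(1), of 0 1] by simp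
    moreover have "card (h ` {..<5}) = 5" "h 0 \<in> h ` {..<5}" "h 1 \<in> h ` {..<5}"
      using h(1) by (auto simp: card_image)
    ultimately show ?R
      using img[OF h(1)] by metis
  next
    assume ?R
    then obtain W a b where W: "card W = 5" "W \<subseteq> {..<n}" "a \<in> W" "b \<in> W" "a \<noteq> b"
      "X = all_edges W - {{a, b}}"
      by blast
    then obtain xs where xs: "distinct (a # b # xs)" "set (a # b # xs) = W" "length xs = 3"
      using card_Diff_doubleton_list[of W 3 a b] by auto
    let ?h = "(!) (a # b # xs)"
    have "inj_on ?h {..<5}"
      using xs by (intro inj_on_nth) auto
    moreover have "?h ` {..<5} = W"
      using xs(2,3) nth_image[of 5 "a # b # xs"] by (simp add: lessThan_atLeast0)
    ultimately show "X \<in> copies {K5_minus} n"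
      unfolding iff using img[of ?h] W by (intro exI[of _ ?h]) (auto simp: K5_minus_def)
  qed
qed

lemma copies_K34:
  "X \<in> copies {K34} n \<longleftrightarrow>
    (\<exists>A B. card A = 3 \<and> card B = 4 \<and> A \<inter> B = {} \<and> A \<union> B \<subseteq> {..<n} \<and> X = bip_edges A B)"
    (is "_ \<longleftrightarrow> ?R")
proof -
  have K: "fst K34 = {..<3} \<union> {3..<7}" "snd K34 = bip_edges {..<3} {3..<7}"
    by (auto simp: K34_def bip_edges_def)
  have "snd K34 \<subseteq> all_edges (fst K34)"
    unfolding K by (rule bip_edges_subset_all_edges) auto
  note iff = copies_singleton[OF this, of X n]
  have img: "(\<lambda>e. h ` e) ` snd K34 = bip_edges (h ` {..<3}) (h ` {3..<7})" for h :: "nat \<Rightarrow> nat"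
    unfolding K bip_edges_image by (auto simp: image_iff) force+
  show ?thesis
  proof
    assume "X \<in> copies {K34} n"
    then obtain h :: "nat \<Rightarrow> nat" where h: "inj_on h ({..<3} \<union> {3..<7})" "h ` ({..<3} \<union> {3..<7}) \<subseteq> {..<n}"
      "X = bip_edges (h ` {..<3}) (h ` {3..<7})"
      unfolding iff img K(1) by blast
    moreover have "h ` {..<3} \<inter> h ` {3..<7} = {}"
      using inj_on_image_Int[OF h(1), of "{..<3}" "{3..<7}"] by auto
    moreover have "card (h ` {..<3}) = 3" "card (h ` {3..<7}) = 4"
      using h(1) by (auto simp: inj_on_Un card_image)
    ultimately show ?R
      by (metis image_Un)
  next
    assume ?R
    then obtain A B where AB: "card A = 3" "card B = 4" "A \<inter> B = {}" "A \<union> B \<subseteq> {..<n}" "X = bip_edges A B"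
      by blast
    have "finite A" "finite B"
      using AB by (auto intro: card_ge_0_finite)
    then obtain f g :: "nat \<Rightarrow> nat" where f: "bij_betw f {..<3} A" and g: "bij_betw g {3..<7} B"
      using finite_same_card_bij[of "{..<3::nat}" A] finite_same_card_bij[of "{3..<7::nat}" B] AB by auto
    define h where "h i = (if i < 3 then f i else g i)" for i :: nat
    have hA: "h ` {..<3} = A" and hB: "h ` {3..<7} = B" and inj: "inj_on h {..<3}" "inj_on h {3..<7}"
      using f g by (auto simp: bij_betw_def h_def inj_on_def image_iff)
    have "inj_on h ({..<3} \<union> {3..<7})"
      using inj hA hB AB(3) by (subst inj_on_Un) (auto simp: Diff_triv disjoint_iff)
    then show "X \<in> copies {K34} n"
      unfolding iff img K(1) image_Un using AB hA hB by (intro exI[of _ h] conjI) simp_all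
  qed
qed

section \<open>Spanning complete and complete bipartite graphs\<close>

lemma obtain_other:
  assumes "finite W" "card S < card W" "finite S"
  obtains x where "x \<in> W" "x \<notin> S"
  using assms by (metis card_mono linorder_not_le subsetI)

text \<open>A new vertex \<open>v\<close> gets one free edge \<open>{v, w}\<close>. Any other edge
  \<open>{v, u}\<close> closes the 4-cycle v, w, x, u for a third vertex \<open>x\<close> of
  \<open>W\<close>.\<close>

lemma spans_C4_complete:
  assumes "finite W" "W \<subseteq> {..<n}"
  shows "spans (copies {C4} n) (all_edges W) (card W)"
  using assms
proof (induction W)
  case empty
  then show ?case
    by (simp add: all_edges_empty spans.empty)
next
  case (insert v W)
  show ?case
  \<comment> \<open>Up to three vertices there are no more edges than vertices; afterwards
    \<open>W\<close> has room for \<open>x\<close>.\<close>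
  proof (cases "card W \<le> 2")
    case True
    then have "card W = 0 \<or> card W = 1 \<or> card W = 2"
      by auto
    then have "card (all_edges (insert v W)) \<le> card (insert v W)"
      using insert.hyps by (auto simp: card_all_edges choose_two)
    then show ?thesis
      using spans_free[OF finite_all_edges, of "insert v W"] insert.hyps spans.weaken by blast
  next
    case False
    then obtain w where w: "w \<in> W"
      by fastforce
    have "spans (copies {C4} n) (all_edges W \<union> {{v, w}} \<union> (\<lambda>w. {v, w}) ` W) (card W + card {{v, w}})"
    proof (rule spans_extend)
      show "spans (copies {C4} n) (all_edges W) (card W)"
        using insert by auto
      fix e assume "e \<in> (\<lambda>w. {v, w}) ` W - {{v, w}}"
      then obtain u where u: "u \<in> W" "e = {v, u}" "u \<noteq> w"
        by auto
      obtain x where x: "x \<in> W" "x \<notin> {u, w}"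
      proof (rule obtain_other)
        show "card {u, w} < card W"
          using False u by simp
      qed (use insert.hyps(1) in auto)
      have "C4_edges v w x u \<in> copies {C4} n"
        unfolding copies_C4 using insert.prems insert.hyps u w x
        by (intro exI[of _ v] exI[of _ w] exI[of _ x] exI[of _ u]) auto
      moreover have "e \<in> C4_edges v w x u" "C4_edges v w x u \<subseteq> insert e (all_edges W \<union> {{v, w}})"
        using u w x by (auto simp: C4_edges_def insert_commute doubleton_in_all_edges)
      ultimately show "\<exists>X\<in>copies {C4} n. e \<in> X \<and> X \<subseteq> insert e (all_edges W \<union> {{v, w}})"
        by blast
    qed (use insert.hyps in auto)
    moreover have "all_edges W \<union> {{v, w}} \<union> (\<lambda>w. {v, w}) ` W = all_edges (insert v W)"
      using all_edges_insert[OF insert.hyps(2)] w by auto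
    ultimately show ?thesis
      using insert.hyps by simp
  qed
qed

text \<open>A star is entirely free. Each further vertex \<open>v\<close> gets one free edge to
  \<open>b\<close>, and every other edge at \<open>v\<close> closes a 4-cycle through
  \<open>b\<close> and an old vertex \<open>a\<close>.\<close>

lemma spans_C4_bip:
  assumes "finite A" "A \<noteq> {}" "finite B" "B \<noteq> {}" "A \<inter> B = {}" "A \<union> B \<subseteq> {..<n}"
  shows "spans (copies {C4} n) (bip_edges A B) (card A + card B - 1)"
  using assms(1,2,5,6)
proof (induction A rule: finite_ne_induct)
  case (singleton a)
  have "card (bip_edges {a} B) \<le> card {a} + card B - 1"
    using card_bip_edges_le[of "{a}" B] assms(3) by simp
  then show ?case
    using spans_free[OF finite_bip_edges, of "{a}" B] assms(3) spans.weaken by blast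
next
  case (insert v A)
  obtain b where b: "b \<in> B"
    using assms(4) by auto
  obtain a where a: "a \<in> A"
    using insert.hyps by auto
  have "spans (copies {C4} n) (bip_edges A B \<union> {{v, b}} \<union> (\<lambda>b. {v, b}) ` B) (card A + card B - 1 + card {{v, b}})"
  proof (rule spans_extend)
    show "spans (copies {C4} n) (bip_edges A B) (card A + card B - 1)"
      using insert by auto
    fix e assume "e \<in> (\<lambda>b. {v, b}) ` B - {{v, b}}"
    then obtain u where u: "u \<in> B" "e = {v, u}" "u \<noteq> b"
      by auto
    have "distinct [v, b, a, u]" "{v, b, a, u} \<subseteq> {..<n}"
      using insert.prems insert.hyps u b a by auto
    then have "C4_edges v b a u \<in> copies {C4} n"
      unfolding copies_C4 by blast
    moreover have "e \<in> C4_edges v b a u" "C4_edges v b a u \<subseteq> insert e (bip_edges A B \<union> {{v, b}})"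
      using u b a bip_edgesI[of a A b B] bip_edgesI[of a A u B] by (auto simp: C4_edges_def insert_commute)
    ultimately show "\<exists>X\<in>copies {C4} n. e \<in> X \<and> X \<subseteq> insert e (bip_edges A B \<union> {{v, b}})"
      by blast
  qed (use assms(3) in auto)
  moreover have "bip_edges A B \<union> {{v, b}} \<union> (\<lambda>b. {v, b}) ` B = bip_edges (insert v A) B"
    using bip_edges_insert[of v A B] b by auto
  moreover have "card A + card B - 1 + card {{v, b}} = card (insert v A) + card B - 1"
    using insert.hyps assms(3,4) card_gt_0_iff[of B] by simp
  ultimately show ?case
    by simp
qed

abbreviation copies_212 :: "nat \<Rightarrow> nat set set set" where
  "copies_212 n \<equiv> copies {K5_minus, K34} n"

lemma copies_212_iff: "X \<in> copies_212 n \<longleftrightarrow> X \<in> copies {K5_minus} n \<or> X \<in> copies {K34} n"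
  using copies_insert[of K5_minus "{K34}" n] by auto

lemma obtain_two:
  assumes "card W \<ge> 2"
  obtains a b where "a \<in> W" "b \<in> W" "a \<noteq> b"
proof -
  have "finite W"
    using assms by (intro card_ge_0_finite) simp
  then show thesis
    using that assms card_le_Suc0_iff_eq[of W] by fastforce
qed

text \<open>A new vertex gets two free edges, to \<open>a\<close> and \<open>b\<close>. Any other
  edge \<open>{v, u}\<close> is the last one missing from a copy on v, a, b, u and a fourth old
  vertex \<open>x\<close>.\<close>

lemma spans_K5_minus_complete:
  assumes "finite W" "W \<subseteq> {..<n}"
  shows "spans (copies_212 n) (all_edges W) (2 * card W - 2)"
  using assms
proof (induction W)
  case empty
  then show ?case
    by (simp add: all_edges_empty spans.empty)
next
  case (insert v W)
  show ?case
  \<comment> \<open>Complete graphs on up to four vertices are free: K_4 has 6 = 2 * 4 - 2 edges.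
    Only afterwards is there a choice for \<open>x\<close>.\<close>
  proof (cases "card W \<le> 3")
    case True
    then have "card W = 0 \<or> card W = 1 \<or> card W = 2 \<or> card W = 3"
      by auto
    then have "card (all_edges (insert v W)) \<le> 2 * card (insert v W) - 2"
      using insert.hyps by (auto simp: card_all_edges choose_two)
    then show ?thesis
      using spans_free[OF finite_all_edges, of "insert v W"] insert.hyps spans.weaken by blast
  next
    case False
    then obtain a b where ab: "a \<in> W" "b \<in> W" "a \<noteq> b"
      using obtain_two[of W] by auto
    let ?S0 = "{{v, a}, {v, b}}"
    have "spans (copies_212 n) (all_edges W \<union> ?S0 \<union> (\<lambda>w. {v, w}) ` W) (2 * card W - 2 + card ?S0)"
    proof (rule spans_extend)
      show "spans (copies_212 n) (all_edges W) (2 * card W - 2)"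
        using insert by auto
      fix e assume "e \<in> (\<lambda>w. {v, w}) ` W - ?S0"
      then obtain u where u: "u \<in> W" "e = {v, u}" "u \<noteq> a" "u \<noteq> b"
        by auto
      have "card {a, b, u} \<le> 3"
        by (simp add: card_insert_if)
      obtain x where x: "x \<in> W" "x \<notin> {a, b, u}"
      proof (rule obtain_other)
        show "card {a, b, u} < card W"
          using False \<open>card {a, b, u} \<le> 3\<close> by linarith
      qed (use insert.hyps(1) in auto)
      let ?W = "{v, a, b, u, x}"
      \<comment> \<open>The nonedge of the copy is put at \<open>{v, x}\<close>, which may still be
        absent; the other edges are \<open>e\<close>, the two free ones and a K_4 inside
        \<open>W\<close>.\<close>
      let ?X = "all_edges ?W - {{v, x}}"
      have d: "v \<notin> {a, b, u, x}" "a \<notin> {b, u, x}" "b \<notin> {u, x}" "u \<notin> {x}"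
        using insert.hyps ab u x by auto
      have "card ?W = 5" "?W \<subseteq> {..<n}" "v \<noteq> x"
        using d insert.prems ab u x by auto
      then have "?X \<in> copies_212 n"
        unfolding copies_212_iff copies_K5_minus by blast
      moreover have "e \<in> ?X"
        using d u by (auto simp: doubleton_in_all_edges doubleton_eq_iff)
      moreover have "?X \<subseteq> insert e (all_edges W \<union> ?S0)"
      proof -
        have "all_edges ?W = all_edges {a, b, u, x} \<union> {{v, a}, {v, b}, {v, u}, {v, x}}"
          using all_edges_insert[OF d(1)] by simp
        moreover have "all_edges {a, b, u, x} \<subseteq> all_edges W"
          using ab u x by (intro all_edges_mono) auto
        ultimately show ?thesis
          using u(2) by blast
      qed
      ultimately show "\<exists>X\<in>copies_212 n. e \<in> X \<and> X \<subseteq> insert e (all_edges W \<union> ?S0)"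
        by (intro bexI[of _ ?X] conjI)
    qed (use insert.hyps in auto)
    moreover have "all_edges W \<union> ?S0 \<union> (\<lambda>w. {v, w}) ` W = all_edges (insert v W)"
      using all_edges_insert[OF insert.hyps(2)] ab by auto
    moreover have "card ?S0 = 2"
      using ab by (auto simp: card_2_iff doubleton_eq_iff)
    moreover have "2 * card W - 2 + 2 = 2 * card (insert v W) - 2"
      using insert.hyps False by simp
    ultimately show ?thesis
      by metis
  qed
qed

text \<open>With two free edges from \<open>v\<close> to \<open>a\<close> and \<open>b\<close>, an
  edge \<open>{v, u}\<close> completes the K_{3,4} with sides \<open>{a, b, u}\<close> and
  \<open>insert v A'\<close>, where \<open>A'\<close> is any three-element subset of
  \<open>A\<close>.\<close>

lemma spans_K34_step:
  assumes A: "finite A" "card A \<ge> 3" and B: "finite B" "card B \<ge> 3"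
    and dis: "insert v A \<inter> B = {}" "insert v A \<union> B \<subseteq> {..<n}" "v \<notin> A"
    and D: "spans (copies_212 n) (bip_edges A B) r"
  shows "spans (copies_212 n) (bip_edges (insert v A) B) (r + 2)"
proof -
  obtain a b where ab: "a \<in> B" "b \<in> B" "a \<noteq> b"
    using obtain_two[of B] B by auto
  obtain A' where A': "A' \<subseteq> A" "card A' = 3"
    using obtain_subset_with_card_n[OF A(2)] by blast
  let ?S0 = "{{v, a}, {v, b}}"
  have "spans (copies_212 n) (bip_edges A B \<union> ?S0 \<union> (\<lambda>w. {v, w}) ` B) (r + card ?S0)"
  proof (rule spans_extend[OF D])
    fix e assume "e \<in> (\<lambda>w. {v, w}) ` B - ?S0"
    then obtain u where u: "u \<in> B" "e = {v, u}" "u \<noteq> a" "u \<noteq> b"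
      by auto
    let ?X = "bip_edges {a, b, u} (insert v A')"
    have "card {a, b, u} = 3"
      using ab u by auto
    moreover have "card (insert v A') = 4"
      using A' dis(3) finite_subset[OF A'(1) A(1)] by (subst card_insert_disjoint) auto
    moreover have "{a, b, u} \<inter> insert v A' = {}" "{a, b, u} \<union> insert v A' \<subseteq> {..<n}"
      using ab u A' dis by auto
    ultimately have "?X \<in> copies_212 n"
      unfolding copies_212_iff copies_K34 by blast
    moreover have X: "?X = bip_edges A' {a, b, u} \<union> (\<lambda>b. {v, b}) ` {a, b, u}"
      using bip_edges_commute[of "{a, b, u}" "insert v A'"] bip_edges_insert[of v A' "{a, b, u}"] by simp
    moreover have "bip_edges A' {a, b, u} \<subseteq> bip_edges A B"
      using ab u A' unfolding bip_edges_def by blast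
    ultimately show "\<exists>X\<in>copies_212 n. e \<in> X \<and> X \<subseteq> insert e (bip_edges A B \<union> ?S0)"
      using u(2) by (intro bexI[of _ ?X]) auto
  qed (use B in auto)
  moreover have "bip_edges A B \<union> ?S0 \<union> (\<lambda>w. {v, w}) ` B = bip_edges (insert v A) B"
    using bip_edges_insert[of v A B] ab by auto
  moreover have "card ?S0 = 2"
    using ab by (auto simp: card_2_iff doubleton_eq_iff)
  ultimately show ?thesis
    by simp
qed

text \<open>If a side has at most two vertices, or both have three, all edges can be free: m \<le>
  2m - 1, 2m \<le> 2m + 1 and 9 = 2 * 6 - 3. Otherwise a vertex is removed from a side of size at
  least four, which leaves the three that the extension step requires.\<close>

lemma spans_K34_bip:
  assumes "finite A" "A \<noteq> {}" "finite B" "B \<noteq> {}" "A \<inter> B = {}" "A \<union> B \<subseteq> {..<n}"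
  shows "spans (copies_212 n) (bip_edges A B) (2 * (card A + card B) - 3)"
  using assms
proof (induction "card A + card B" arbitrary: A B rule: less_induct)
  case less
  \<comment> \<open>Stated for arbitrary sides so that it applies with the roles of \<open>A\<close>
    and \<open>B\<close> exchanged.\<close>
  have grow: "spans (copies_212 n) (bip_edges A B) (2 * (card A + card B) - 3)"
    if A: "card A \<ge> 4" "card B \<ge> 3" "finite A" "finite B" "A \<inter> B = {}" "A \<union> B \<subseteq> {..<n}"
      and IH: "\<And>v. v \<in> A \<Longrightarrow> spans (copies_212 n) (bip_edges (A - {v}) B) (2 * (card (A - {v}) + card B) - 3)"
    for A B
  proof -
    obtain v where v: "v \<in> A"
      using A(1) by fastforce
    have c: "card (A - {v}) = card A - 1"
      using v A by simp
    have "spans (copies_212 n) (bip_edges (insert v (A - {v})) B) (2 * (card (A - {v}) + card B) - 3 + 2)"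
      using A v c by (intro spans_K34_step IH) auto
    moreover have "2 * (card (A - {v}) + card B) - 3 + 2 = 2 * (card A + card B) - 3"
      using c A by simp
    ultimately show ?thesis
      using v by (simp add: insert_absorb)
  qed
  have ne: "card A \<noteq> 0" "card B \<noteq> 0"
    using less.prems by auto
  consider "card A \<ge> 4" "card B \<ge> 3" | "card B \<ge> 4" "card A \<ge> 3" | "card A = 3" "card B = 3"
    | "card A \<le> 2" | "card B \<le> 2"
    by linarith
  then show ?case
  proof cases
    case 1
    show ?thesis
    proof (rule grow[OF 1])
      fix v assume v: "v \<in> A"
      show "spans (copies_212 n) (bip_edges (A - {v}) B) (2 * (card (A - {v}) + card B) - 3)"
      proof (rule less.hyps)
        have "card (A - {v}) = card A - 1"
          using v less.prems by simp
        then show "card (A - {v}) + card B < card A + card B" "A - {v} \<noteq> {}"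
          using 1 by (simp, metis card.empty diff_is_0_eq numeral_le_one_iff le_trans semiring_norm(69))
      qed (use less.prems in auto)
    qed (use less.prems in auto)
  next
    case 2
    have "spans (copies_212 n) (bip_edges B A) (2 * (card B + card A) - 3)"
    proof (rule grow[OF 2])
      fix v assume v: "v \<in> B"
      have "spans (copies_212 n) (bip_edges A (B - {v})) (2 * (card A + card (B - {v})) - 3)"
      proof (rule less.hyps)
        have "card (B - {v}) = card B - 1"
          using v less.prems by simp
        then show "card A + card (B - {v}) < card A + card B" "B - {v} \<noteq> {}"
          using 2 by (simp, metis card.empty diff_is_0_eq numeral_le_one_iff le_trans semiring_norm(69))
      qed (use less.prems in auto)
      then show "spans (copies_212 n) (bip_edges (B - {v}) A) (2 * (card (B - {v}) + card A) - 3)"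
        by (simp add: bip_edges_commute add.commute)
    qed (use less.prems in auto)
    then show ?thesis
      by (simp add: bip_edges_commute add.commute)
  next
    case 3
    then have "card (bip_edges A B) \<le> 2 * (card A + card B) - 3"
      using card_bip_edges[of A B] less.prems by simp
    then show ?thesis
      using spans_free[OF finite_bip_edges, of A B] less.prems spans.weaken by blast
  next
    case 4
    then have "card A = 1 \<or> card A = 2"
      using ne by linarith
    then have "card (bip_edges A B) \<le> 2 * (card A + card B) - 3"
      using card_bip_edges[of A B] less.prems ne by auto
    then show ?thesis
      using spans_free[OF finite_bip_edges, of A B] less.prems spans.weaken by blast
  next
    case 5
    then have "card B = 1 \<or> card B = 2"
      using ne by linarith
    then have "card (bip_edges A B) \<le> 2 * (card A + card B) - 3"
      using card_bip_edges[of A B] less.prems ne by auto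
    then show ?thesis
      using spans_free[OF finite_bip_edges, of A B] less.prems spans.weaken by blast
  qed
qed

section \<open>The even cycle matroid\<close>

lemma g_fun_110: "g_fun 1 1 0 = even_rank"
  by (auto simp: g_fun_def even_rank_def incident_vertices_def)

lemma g_fun_212: "g_fun 2 1 2 F = int (card (\<Union>F)) + even_rank F - 2"
  by (simp add: g_fun_def even_rank_def incident_vertices_def)

lemma count_function_110:
  assumes "finite V"
  shows "count_function (all_edges V) (g_fun 1 1 0)"
  unfolding g_fun_110
proof
  show "finite (all_edges V)"
    using assms by (rule finite_all_edges)
qed (rule even_rank_mono[OF assms] even_rank_submodular[OF assms] even_rank_singleton[OF assms];
    assumption)+

lemma even_rank_le_add_card:
  assumes V: "finite V" and I: "I \<subseteq> all_edges V" and S: "finite S" "S \<subseteq> all_edges V"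
  shows "even_rank (I \<union> S) \<le> even_rank I + int (card S)"
  using S
proof (induction S)
  case (insert e S)
  have "even_rank (insert e (I \<union> S)) \<le> even_rank (I \<union> S) + 1"
    using insert.prems I by (intro even_rank_insert_le[OF V]) auto
  then show ?case
    using insert by simp
qed simp

text \<open>\<open>even_rank\<close> grows by at most one per edge, so a shortfall on a subset would
  persist up to \<open>F\<close>.\<close>

lemma indep_110I:
  assumes V: "finite V" and F: "F \<subseteq> all_edges V" "int (card F) \<le> even_rank F"
  shows "F \<in> count_indep (g_fun 1 1 0) (all_edges V)"
proof -
  have "int (card I) \<le> even_rank I" if I: "I \<subseteq> F" for I
  proof -
    have fin: "finite F"
      using F finite_all_edges[OF V] finite_subset by blast
    have "even_rank (I \<union> (F - I)) \<le> even_rank I + int (card (F - I))"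
      using F I fin by (intro even_rank_le_add_card[OF V]) auto
    moreover have "I \<union> (F - I) = F"
      using I by auto
    moreover have "card (F - I) + card I = card F"
      using fin I card_Diff_subset[of I F] card_mono[of F I] finite_subset by fastforce
    ultimately show ?thesis
      using F by simp
  qed
  then show ?thesis
    using F by (simp add: count_indep_def g_fun_110)
qed

lemma even_rank_path3:
  assumes V: "finite V" and d: "distinct [a, b, c, d]" "{a, b, c, d} \<subseteq> V"
  shows "even_rank {{a, b}, {b, c}, {c, d}} \<ge> 3"
proof -
  have "even_rank {{a, b}} = 1"
    using d by (intro even_rank_singleton[OF V]) (auto simp: doubleton_in_all_edges)
  \<comment> \<open>\<open>even_rank_pendant\<close> expects the new vertex first, hence
    \<open>{c, b}\<close> and then \<open>{d, c}\<close>.\<close>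
  moreover have "even_rank {{a, b}} + 1 \<le> even_rank (insert {c, b} {{a, b}})"
    using d by (intro even_rank_pendant[OF V]) (auto simp: doubleton_in_all_edges)
  moreover have "even_rank {{c, b}, {a, b}} + 1 \<le> even_rank (insert {d, c} {{c, b}, {a, b}})"
    using d by (intro even_rank_pendant[OF V]) (auto simp: doubleton_in_all_edges)
  moreover have "{{d, c}, {c, b}, {a, b}} = {{a, b}, {b, c}, {c, d}}"
    by auto
  ultimately show ?thesis
    by simp
qed

lemma C4_edges_rotate: "C4_edges a b c d = C4_edges b c d a"
  by (auto simp: C4_edges_def)

lemma C4_edges_Diff_indep:
  assumes V: "finite V" and d: "distinct [a, b, c, d]" "{a, b, c, d} \<subseteq> V"
  shows "C4_edges a b c d - {{d, a}} \<in> count_indep (g_fun 1 1 0) (all_edges V)"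
proof (rule indep_110I[OF V])
  have *: "C4_edges a b c d - {{d, a}} = {{a, b}, {b, c}, {c, d}}"
    using d by (auto simp: C4_edges_def doubleton_eq_iff)
  show "C4_edges a b c d - {{d, a}} \<subseteq> all_edges V"
    using d unfolding * by (simp add: doubleton_in_all_edges)
  show "int (card (C4_edges a b c d - {{d, a}})) \<le> even_rank (C4_edges a b c d - {{d, a}})"
    using even_rank_path3[OF V d] card_length[of "[{a, b}, {b, c}, {c, d}]"] unfolding * by simp
qed

lemma circuit_if_deletions_indep:
  assumes "X \<subseteq> E" "X \<notin> \<I>" "\<And>I J. I \<in> \<I> \<Longrightarrow> J \<subseteq> I \<Longrightarrow> J \<in> \<I>" "\<And>e. e \<in> X \<Longrightarrow> X - {e} \<in> \<I>"
  shows "circuit E \<I> X"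
  unfolding circuit_def
proof (intro conjI allI impI)
  fix D assume "D \<subset> X"
  then obtain e where "e \<in> X" "D \<subseteq> X - {e}"
    by blast
  then show "D \<in> \<I>"
    using assms(3,4) by blast
qed (use assms in auto)

lemma count_indep_subset: "I \<in> count_indep g E \<Longrightarrow> J \<subseteq> I \<Longrightarrow> J \<in> count_indep g E"
  unfolding count_indep_def by blast

text \<open>A 4-cycle is bipartite, so its rank is at most 4 - 1. Deleting an edge leaves a path,
  and rotations turn any edge into the closing one.\<close>

lemma circuit_C4:
  assumes "X \<in> copies {C4} n"
  shows "circuit (all_edges {..<n}) (M_g 1 1 0 n) X"
proof -
  obtain a b c d where d: "distinct [a, b, c, d]" "{a, b, c, d} \<subseteq> {..<n}" and X: "X = C4_edges a b c d"
    using assms unfolding copies_C4 by (elim exE conjE) (rule that)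
  have XE: "X \<subseteq> all_edges {..<n}"
    using d unfolding X C4_edges_def by (simp add: doubleton_in_all_edges)
  have "X \<subseteq> bip_edges {a, c} {b, d}"
    by (auto simp: X C4_edges_def bip_edges_def)
  then have "beta X \<ge> 1"
    using XE d X by (intro beta_pos_if_bipartite[of X "{..<n}" "{a, c}" "{b, d}"]) (auto simp: C4_edges_def)
  moreover have "\<Union>X = {a, b, c, d}"
    by (auto simp: X C4_edges_def)
  moreover have "card X = 4"
    using d by (simp add: X C4_edges_def doubleton_eq_iff)
  ultimately have "even_rank X < int (card X)"
    using d by (simp add: even_rank_def)
  moreover have "X \<noteq> {}"
    by (simp add: X C4_edges_def)
  ultimately have dep: "X \<notin> M_g 1 1 0 n"
    unfolding count_indep_def g_fun_110 by (auto simp: not_le)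
  show ?thesis
  proof (rule circuit_if_deletions_indep[OF XE dep])
    fix e assume "e \<in> X"
    then have "e = {d, a} \<or> e = {a, b} \<or> e = {b, c} \<or> e = {c, d}"
      by (auto simp: X C4_edges_def)
    then show "X - {e} \<in> M_g 1 1 0 n"
      using C4_edges_Diff_indep[of "{..<n}" a b c d] C4_edges_Diff_indep[of "{..<n}" b c d a]
        C4_edges_Diff_indep[of "{..<n}" c d a b] C4_edges_Diff_indep[of "{..<n}" d a b c] d
        C4_edges_rotate[of a b c d] C4_edges_rotate[of b c d a] C4_edges_rotate[of c d a b]
      by (auto simp: X snd_complete_graph)
  qed (rule count_indep_subset)
qed

section \<open>Tight sets of the even cycle matroid\<close>

lemma finite_components:
  assumes "finite V" "F \<subseteq> all_edges V"
  shows "finite (components F)" "C \<in> components F \<Longrightarrow> finite C"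
proof -
  have "finite (\<Union>F)"
    using Union_all_edges[OF assms(2)] assms(1) finite_subset by blast
  then show "finite (components F)" "C \<in> components F \<Longrightarrow> finite C"
    using Union_components[of F] finite_UnionD finite_subset by (metis, metis Union_upper)
qed

lemma component_has_edge:
  assumes "F \<subseteq> all_edges V" "C \<in> components F"
  obtains e where "e \<in> F" "e \<subseteq> C"
proof -
  obtain v where v: "v \<in> \<Union>F" "C = connected_rel F `` {v}"
    using assms(2) by (auto simp: components_eq)
  then have "v \<in> C"
    using connected_rel_refl by fast
  then show thesis
    using v that edge_in_component[OF assms(1) _ assms(2)] by blast
qed

lemma bip_component_sides:
  assumes "F \<subseteq> all_edges V" "C \<in> bip_components F"
  shows "side F C \<subseteq> C" "side F C \<noteq> {}" "C - side F C \<noteq> {}"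
    "{e \<in> F. e \<subseteq> C} \<subseteq> bip_edges (side F C) (C - side F C)"
proof -
  have C: "C \<in> components F" "bipartite (C, {e \<in> F. e \<subseteq> C})"
    using assms(2) by (auto simp: bip_components_def)
  note s = side[OF C(2)]
  obtain e where "e \<in> F" "e \<subseteq> C"
    using component_has_edge[OF assms(1) C(1)] .
  then have "e \<in> bip_edges (side F C) (C - side F C)"
    using s by blast
  then show "side F C \<noteq> {}" "C - side F C \<noteq> {}"
    by (auto simp: bip_edges_def)
  show "side F C \<subseteq> C" "{e \<in> F. e \<subseteq> C} \<subseteq> bip_edges (side F C) (C - side F C)"
    by (fact s)+
qed

lemma card_Union_components:
  assumes "finite V" "F \<subseteq> all_edges V"
  shows "card (\<Union>F) = (\<Sum>C\<in>components F. card C)"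
  using card_Union_disjoint[of "components F"] disjoint_components[of F] finite_components[OF assms]
  by (simp add: Union_components disjoint_def pairwise_def disjnt_def)

text \<open>The closure lies in the complete graph on the pooled nonbipartite vertices
  \<open>?W\<close> together with a complete bipartite graph for each bipartite component. The
  charges |W| and |C| - 1 add up to \<open>even_rank T\<close>, which is
  \<open>card T\<close>.\<close>

lemma span_tight_110:
  assumes T: "T \<subseteq> all_edges {..<n}" "int (card T) = even_rank T"
  shows "\<exists>K. {e \<in> all_edges {..<n}. even_rank (insert e T) = even_rank T} \<subseteq> K \<and>
    spans (copies {C4} n) K (card T)"
proof -
  let ?W = "nonbip_vertices T" and ?B = "bip_components T"
  let ?b = "\<lambda>C. bip_edges (side T C) (C - side T C)"
  let ?K = "all_edges ?W \<union> (\<Union>C\<in>?B. ?b C)"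
  have V: "finite {..<n}"
    by simp
  note fin = finite_components[OF V T(1)]
  have BC: "?B \<subseteq> components T"
    by (auto simp: bip_components_def)
  have Cn: "C \<subseteq> {..<n}" if "C \<in> components T" for C
    using Union_components[of T] Union_all_edges[OF T(1)] that by blast
  have W: "?W \<subseteq> {..<n}"
    using Cn by (auto simp: nonbip_vertices_def)
  have card_W: "card ?W = (\<Sum>C\<in>components T - ?B. card C)"
    unfolding nonbip_vertices_def using disjoint_components[of T] fin
    by (intro card_Union_disjoint) (auto simp: disjoint_def pairwise_def disjnt_def)
  \<comment> \<open>Makes the natural number \<open>card C - 1\<close> an honest difference in the
    sum below.\<close>
  have pos: "card C \<ge> 1" if "C \<in> ?B" for C
    using bip_component_sides[OF T(1) that] fin(2)[of C] BC that card_gt_0_iff[of C]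
    by (auto simp: Suc_le_eq)
  have "spans (copies {C4} n) (?b C) (card C - 1)" if C: "C \<in> ?B" for C
  proof -
    note s = bip_component_sides[OF T(1) C]
    have "finite C" "C \<subseteq> {..<n}"
      using fin BC C Cn by auto
    then have "spans (copies {C4} n) (?b C) (card (side T C) + card (C - side T C) - 1)"
      using s finite_subset[OF s(1)] by (intro spans_C4_bip) auto
    moreover have "card (side T C) + card (C - side T C) = card C"
      using s(1) \<open>finite C\<close> card_Diff_subset[of "side T C" C] card_mono[of C "side T C"] finite_subset
      by fastforce
    ultimately show ?thesis
      by simp
  qed
  then have "spans (copies {C4} n) ?K (card ?W + (\<Sum>C\<in>?B. card C - 1))"
    using finite_subset[OF W] finite_subset[OF BC fin(1)] W
    by (intro spans_Un spans_C4_complete spans_UN) auto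
  moreover have "card ?W + (\<Sum>C\<in>?B. card C - 1) = card T"
  proof -
    have "(\<Sum>C\<in>?B. card C) = (\<Sum>C\<in>?B. (card C - 1) + 1)"
      by (intro sum.cong refl) (use pos in force)
    also have "\<dots> = (\<Sum>C\<in>?B. card C - 1) + card ?B"
      by (simp only: sum.distrib card_eq_sum)
    finally have "(\<Sum>C\<in>?B. card C) = (\<Sum>C\<in>?B. card C - 1) + beta T"
      by (simp add: beta_eq)
    moreover have "card (\<Union>T) = card ?W + (\<Sum>C\<in>?B. card C)"
      unfolding card_Union_components[OF V T(1)] card_W by (rule sum.subset_diff[OF BC fin(1)])
    ultimately have "card (\<Union>T) = card ?W + (\<Sum>C\<in>?B. card C - 1) + beta T"
      by (simp only: add.assoc)
    then show ?thesis
      using T(2) unfolding even_rank_def by linarith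
  qed
  moreover have "{e \<in> all_edges {..<n}. even_rank (insert e T) = even_rank T} \<subseteq> ?K"
    using even_rank_eq_insert[OF V T(1)] by blast
  ultimately show ?thesis
    by (intro exI[of _ ?K] conjI) simp_all
qed

theorem even_cycle_matroid_maximal:
  "unique_maximal_H_matroid {C4} n (M_g 1 1 0 n) \<and>
    (\<forall>F. F \<subseteq> snd (complete_graph n) \<longrightarrow> int (rank_of (M_g 1 1 0 n) F) = val_H {C4} n F)"
proof -
  interpret count_function "all_edges {..<n}" "g_fun 1 1 0"
    by (rule count_function_110) simp
  show ?thesis
  proof (rule unique_maximal_and_rank_eq_val)
    show "H_matroid {C4} n (M_g 1 1 0 n)"
      using matroid_count_indep circuit_C4 by (simp add: H_matroid_def snd_complete_graph)
    fix F assume "F \<subseteq> snd (complete_graph n)"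
    then show "\<exists>I\<in>M_g 1 1 0 n. I \<subseteq> F \<and>
        (\<exists>Xs. proper_sequence (copies {C4} n) Xs \<and> val_seq F Xs \<le> int (card I))"
      unfolding snd_complete_graph
    proof (rule spanning_sequence_exists[rotated])
      fix T assume T: "T \<in> count_indep (g_fun 1 1 0) (all_edges {..<n})" "tight T"
      have "int (card T) = even_rank T"
        using T(2) by (simp add: tight_def flip: g_fun_110)
      then show "\<exists>K. cl T \<subseteq> K \<and> spans (copies {C4} n) K (card T)"
        using span_tight_110[OF indepD(1)[OF T(1)]] by (simp add: cl_def flip: g_fun_110)
    qed
  qed
qed

section \<open>The matroid of \<open>g_fun 2 1 2\<close>\<close>

text \<open>By \<open>g_fun_212\<close> the function is |V(F)|, a coverage function, plus
  \<open>even_rank\<close>, minus 2. Both summands are monotone and submodular, and on an edge the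
  value is 2 + 1 - 2.\<close>

lemma count_function_212:
  assumes V: "finite V"
  shows "count_function (all_edges V) (g_fun 2 1 2)"
proof
  have fin: "finite (\<Union>A)" if "A \<subseteq> all_edges V" for A
    using Union_all_edges[OF that] V finite_subset by blast
  show "finite (all_edges V)"
    using V by (rule finite_all_edges)
  show "g_fun 2 1 2 A \<le> g_fun 2 1 2 B" if "A \<subseteq> B" "B \<subseteq> all_edges V" for A B
    using even_rank_mono[OF V that(2,1)] card_mono[OF fin[OF that(2)] Union_mono[OF that(1)]]
    by (simp add: g_fun_212)
  show "g_fun 2 1 2 (A \<union> B) + g_fun 2 1 2 (A \<inter> B) \<le> g_fun 2 1 2 A + g_fun 2 1 2 B"
    if A: "A \<subseteq> all_edges V" and B: "B \<subseteq> all_edges V" for A B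
  proof -
    have "card (\<Union>(A \<inter> B)) \<le> card (\<Union>A \<inter> \<Union>B)"
      using fin[OF A] by (intro card_mono) auto
    moreover have "card (\<Union>A) + card (\<Union>B) = card (\<Union>(A \<union> B)) + card (\<Union>A \<inter> \<Union>B)"
      using card_Un_Int[OF fin[OF A] fin[OF B]] by simp
    ultimately show ?thesis
      using even_rank_submodular[OF V A B] by (simp add: g_fun_212)
  qed
  show "g_fun 2 1 2 {e} = 1" if "e \<in> all_edges V" for e
    using even_rank_singleton[OF V that] that by (simp add: g_fun_212 all_edges_def)
qed

section \<open>Independent graphs obtained by attaching vertices of degree two\<close>

abbreviation indep_212 :: "'a set \<Rightarrow> 'a set set set" where
  "indep_212 V \<equiv> count_indep (g_fun 2 1 2) (all_edges V)"

lemma indep_212D: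
  assumes "I \<in> indep_212 V" "J \<subseteq> I" "J \<noteq> {}"
  shows "int (card J) \<le> int (card (\<Union>J)) + even_rank J - 2"
  using assms unfolding count_indep_def by (auto simp: g_fun_212)

text \<open>The 0-extension of rigidity theory: a subset using the new vertex \<open>v\<close> gains
  at least one in the number of vertices and one in \<open>even_rank\<close>, which pays for two
  edges. The case \<open>u = w\<close> is allowed and attaches a single edge.\<close>

lemma zero_extension:
  assumes V: "finite V" and I: "I \<in> indep_212 V"
    and v: "v \<in> V" "v \<notin> \<Union>I" and uw: "u \<in> V" "w \<in> V" "u \<noteq> v" "w \<noteq> v"
  shows "insert {v, u} (insert {v, w} I) \<in> indep_212 V"
proof -
  have IV: "I \<subseteq> all_edges V"
    using I by (simp add: count_indep_def)
  have ee: "{v, u} \<in> all_edges V" "{v, w} \<in> all_edges V"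
    using v uw by (auto simp: doubleton_in_all_edges)
  have "int (card S) \<le> g_fun 2 1 2 S" if S: "S \<subseteq> insert {v, u} (insert {v, w} I)" "S \<noteq> {}" for S
  proof (cases "S \<subseteq> I")
    case True
    then show ?thesis
      using I S by (auto simp: count_indep_def)
  next
    case False
    define S0 where "S0 = S \<inter> I"
    have SV: "S \<subseteq> all_edges V" and S0V: "S0 \<subseteq> all_edges V"
      using S IV ee by (auto simp: S0_def)
    then have fin: "finite S" "finite (\<Union>S)" "finite S0" "finite (\<Union>S0)"
      using finite_subset[OF _ finite_all_edges[OF V]] finite_subset[OF Union_all_edges V] by simp_all
    obtain t where t: "t = u \<or> t = w" "{v, t} \<in> S"
      using False S by auto
    have "v \<notin> \<Union>S0"
      using v by (auto simp: S0_def)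
    have "even_rank S0 + 1 \<le> even_rank (insert {v, t} S0)"
      using t SV \<open>v \<notin> \<Union>S0\<close> by (intro even_rank_pendant[OF V S0V]) auto
    also have "\<dots> \<le> even_rank S"
      using t by (intro even_rank_mono[OF V SV]) (auto simp: S0_def)
    finally have rank: "even_rank S0 + 1 \<le> even_rank S" .
    have "card (insert v (\<Union>S0)) \<le> card (\<Union>S)"
      using fin t by (intro card_mono) (auto simp: S0_def)
    then have verts: "card (\<Union>S0) + 1 \<le> card (\<Union>S)"
      using fin \<open>v \<notin> \<Union>S0\<close> by simp
    show ?thesis
    \<comment> \<open>The empty set is exempt from the independence inequality and has value -2, so
      sets consisting of new edges only are counted directly.\<close>
    proof (cases "S0 = {}")
      case False
      have "S \<subseteq> S0 \<union> {{v, u}, {v, w}}"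
        using S(1) unfolding S0_def by blast
      then have "card S \<le> card (S0 \<union> {{v, u}, {v, w}})"
        using fin by (intro card_mono) auto
      also have "\<dots> \<le> card S0 + card {{v, u}, {v, w}}"
        by (rule card_Un_le)
      also have "\<dots> \<le> card S0 + 2"
        by (simp add: card_insert_if)
      finally have "card S \<le> card S0 + 2" .
      moreover have "int (card S0) \<le> int (card (\<Union>S0)) + even_rank S0 - 2"
        using indep_212D[OF I, of S0] False by (auto simp: S0_def)
      ultimately show ?thesis
        using rank verts by (simp add: g_fun_212)
    next
      case True
      then have S': "S \<subseteq> {{v, u}, {v, w}}"
        using S by (auto simp: S0_def)
      show ?thesis
      proof (cases "S = {{v, t}}")
        case True
        then show ?thesis
          using even_rank_singleton[OF V, of "{v, t}"] SV t uw by (auto simp: g_fun_212)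
      next
        case False
        then have S2: "S = {{w, v}, {v, u}}" and "u \<noteq> w"
          using S' t by (auto simp: insert_commute)
        have "even_rank {{v, u}} + 1 \<le> even_rank S"
          unfolding S2 using ee uw \<open>u \<noteq> w\<close>
          by (intro even_rank_pendant[OF V]) (auto simp: insert_commute)
        moreover have "even_rank {{v, u}} = 1"
          using even_rank_singleton[OF V ee(1)] .
        moreover have "\<Union>S = {w, v, u}"
          using S2 by auto
        moreover have "card S \<le> 2"
          unfolding S2 by (simp add: card_insert_if)
        ultimately show ?thesis
          using uw \<open>u \<noteq> w\<close> by (simp add: g_fun_212)
      qed
    qed
  qed
  then show ?thesis
    using IV ee by (simp add: count_indep_def)
qed

text \<open>Because of the constant -2 the inequality for \<open>D\<close> does not pass to subsets
  as it does for \<open>even_rank\<close>; proper subsets are handled through one-edge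
  deletions.\<close>

lemma indep_212_if_deletions:
  assumes "D \<subseteq> all_edges V" "\<And>e. e \<in> D \<Longrightarrow> D - {e} \<in> indep_212 V"
    and "int (card D) \<le> g_fun 2 1 2 D"
  shows "D \<in> indep_212 V"
proof -
  have "int (card I) \<le> g_fun 2 1 2 I" if I: "I \<subseteq> D" "I \<noteq> {}" for I
  proof (cases "I = D")
    case False
    then obtain e where "e \<in> D" "I \<subseteq> D - {e}"
      using I by blast
    then show ?thesis
      using assms(2) I(2) unfolding count_indep_def by blast
  qed (use assms in simp)
  then show ?thesis
    using assms(1) by (simp add: count_indep_def)
qed

lemma empty_indep_212: "{} \<in> indep_212 V"
  by (simp add: count_indep_def)

lemma even_rank_triangle:
  assumes V: "finite V" and d: "distinct [a, b, c]" "{a, b, c} \<subseteq> V"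
  shows "even_rank {{a, b}, {b, c}, {c, a}} \<ge> 3"
proof -
  have "even_rank {{a, b}} = 1"
    using d by (intro even_rank_singleton[OF V]) (auto simp: doubleton_in_all_edges)
  moreover have "even_rank {{a, b}} + 1 \<le> even_rank (insert {c, b} {{a, b}})"
    using d by (intro even_rank_pendant[OF V]) (auto simp: doubleton_in_all_edges)
  moreover have "even_rank {{c, b}, {a, b}} + 1 \<le> even_rank (insert {c, a} {{c, b}, {a, b}})"
  proof (rule even_rank_less[OF V])
    \<comment> \<open>The two-colouring of the path a, b, c. The closing edge joins two labels 1,
      whose sum is nonzero modulo 3.\<close>
    let ?x = "\<lambda>w. if w = a \<or> w = c then 1 else if w = b then - 1 else 0 :: 3"
    show "?x \<in> antisymmetric_labellings V {{c, b}, {a, b}}"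
      using d by (auto simp: antisymmetric_labellings_def doubleton_eq_iff)
    show "?x c + ?x a \<noteq> 0"
      by simp
  qed (use d in \<open>auto simp: doubleton_in_all_edges\<close>)
  moreover have "{{c, a}, {c, b}, {a, b}} = {{a, b}, {b, c}, {c, a}}"
    by auto
  ultimately show ?thesis
    by simp
qed

lemma even_rank_triangle_pendant:
  assumes V: "finite V" and d: "distinct [a, b, c, v]" "{a, b, c, v} \<subseteq> V"
  shows "even_rank {{v, a}, {a, b}, {b, c}, {c, a}} \<ge> 4"
proof -
  have "even_rank {{a, b}, {b, c}, {c, a}} + 1 \<le> even_rank (insert {v, a} {{a, b}, {b, c}, {c, a}})"
    using d by (intro even_rank_pendant[OF V]) (auto simp: doubleton_in_all_edges)
  then show ?thesis
    using even_rank_triangle[OF V, of a b c] d by simp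
qed

lemma even_rank_triangle_two_pendants:
  assumes V: "finite V" and d: "distinct [a, b, c, v, w]" "{a, b, c, v, w} \<subseteq> V"
  shows "even_rank {{w, a}, {v, a}, {a, b}, {b, c}, {c, a}} \<ge> 5"
proof -
  have "even_rank {{v, a}, {a, b}, {b, c}, {c, a}} + 1 \<le>
      even_rank (insert {w, a} {{v, a}, {a, b}, {b, c}, {c, a}})"
    using d by (intro even_rank_pendant[OF V]) (auto simp: doubleton_in_all_edges)
  then show ?thesis
    using even_rank_triangle_pendant[OF V, of a b c v] d by simp
qed

lemma Union_all_edges_eq:
  assumes "card W \<ge> 2"
  shows "\<Union>(all_edges W) = W"
proof
  show "W \<subseteq> \<Union>(all_edges W)"
  proof
    fix w assume "w \<in> W"
    moreover obtain a b where "a \<in> W" "b \<in> W" "a \<noteq> b"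
      using obtain_two[OF assms] .
    ultimately have "{w, a} \<in> all_edges W \<or> {w, b} \<in> all_edges W"
      by (auto simp: doubleton_in_all_edges)
    then show "w \<in> \<Union>(all_edges W)"
      by auto
  qed
qed (rule Union_all_edges, simp)

text \<open>Without the edge pq the graph arises from rs by attaching p and q. The full K_4 meets
  the bound exactly, 6 = 4 + 4 - 2, its rank 4 being witnessed by a triangle with a pendant
  edge.\<close>

lemma K4_indep_212:
  assumes V: "finite V" and W: "card W = 4" "W \<subseteq> V"
  shows "all_edges W \<in> indep_212 V"
proof (rule indep_212_if_deletions)
  show "all_edges W \<subseteq> all_edges V"
    using W(2) by (rule all_edges_mono)
  show "all_edges W - {e} \<in> indep_212 V" if e: "e \<in> all_edges W" for e
  proof -
    obtain p q where pq: "e = {p, q}" "p \<noteq> q" "p \<in> W" "q \<in> W"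
      using obtain_edge[OF e] .
    then obtain xs where xs: "distinct (p # q # xs)" "set (p # q # xs) = W" "length xs = 2"
      using card_Diff_doubleton_list[of W 2 p q] W(1) by auto
    then obtain r s where "xs = [r, s]"
      by (auto simp: length_Suc_conv numeral_2_eq_2)
    then have d: "p \<notin> {q, r, s}" "q \<notin> {r, s}" "r \<notin> {s}" and W': "W = {p, q, r, s}"
      using xs by auto
    have inV: "p \<in> V" "q \<in> V" "r \<in> V" "s \<in> V"
      using W W' by auto
    \<comment> \<open>A zero extension with equal neighbours produces the single edge rs.\<close>
    have "insert {r, s} (insert {r, s} {}) \<in> indep_212 V"
      using d inV by (intro zero_extension[OF V] empty_indep_212) auto
    then have rs: "{{r, s}} \<in> indep_212 V"
      by simp
    have prs: "{{p, r}, {p, s}, {r, s}} \<in> indep_212 V"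
      using d inV by (intro zero_extension[OF V rs]) auto
    have "insert {q, r} (insert {q, s} {{p, r}, {p, s}, {r, s}}) \<in> indep_212 V"
      using d inV by (intro zero_extension[OF V prs]) auto
    moreover have "all_edges W - {e} \<subseteq> insert {q, r} (insert {q, s} {{p, r}, {p, s}, {r, s}})"
      unfolding W' all_edges_insert[OF d(1)] all_edges_insert[OF d(2)] all_edges_insert[OF d(3)] pq(1)
      using all_edges_insert[of s "{}"] by (auto simp: all_edges_empty)
    ultimately show ?thesis
      by (rule count_indep_subset)
  qed
  obtain a b where ab: "a \<in> W" "b \<in> W" "a \<noteq> b"
    using obtain_two[of W] W by auto
  then obtain xs where xs: "distinct (a # b # xs)" "set (a # b # xs) = W" "length xs = 2"
    using card_Diff_doubleton_list[of W 2 a b] W(1) by auto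
  then obtain c d where "xs = [c, d]"
    by (auto simp: length_Suc_conv numeral_2_eq_2)
  then have d: "distinct [a, b, c, d]" "W = {a, b, c, d}"
    using xs by auto
  have "even_rank {{d, a}, {a, b}, {b, c}, {c, a}} \<le> even_rank (all_edges W)"
    using d W by (intro even_rank_mono[OF V all_edges_mono]) (auto simp: doubleton_in_all_edges)
  then have "4 \<le> even_rank (all_edges W)"
    using even_rank_triangle_pendant[OF V, of a b c d] d W by simp
  moreover have "card (all_edges W) = 6"
    using W finite_subset[OF W(2) V] by (simp add: card_all_edges choose_two)
  ultimately show "int (card (all_edges W)) \<le> g_fun 2 1 2 (all_edges W)"
    using Union_all_edges_eq[of W] W by (simp add: g_fun_212)
qed

text \<open>The common end \<open>p\<close> of the two missing edges keeps degree two, so this is a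
  zero extension of K_4.\<close>

lemma K5_minus_two_adjacent_indep_212:
  assumes V: "finite V" and W: "card W = 5" "W \<subseteq> V" and p: "p \<in> W" "q \<in> W" "r \<in> W" "distinct [p, q, r]"
  shows "all_edges W - {{p, q}, {p, r}} \<in> indep_212 V"
proof -
  have finW: "finite W"
    using W V finite_subset by blast
  have c4: "card (W - {p}) = 4"
    using W p finW by simp
  have "card (W - {p, q, r}) = 2"
    using W p finW by (subst card_Diff_subset) auto
  then obtain s t where st: "W - {p, q, r} = {s, t}" "s \<noteq> t"
    by (auto simp: card_2_iff)
  have K4: "all_edges (W - {p}) \<in> indep_212 V"
    using c4 W by (intro K4_indep_212[OF V]) auto
  have "insert {p, s} (insert {p, t} (all_edges (W - {p}))) \<in> indep_212 V"
  proof (rule zero_extension[OF V K4])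
    show "p \<notin> \<Union>(all_edges (W - {p}))"
      by (auto simp: all_edges_def)
  qed (use st W p in auto)
  moreover have "all_edges W - {{p, q}, {p, r}} \<subseteq> insert {p, s} (insert {p, t} (all_edges (W - {p})))"
  proof -
    have "all_edges W = all_edges (W - {p}) \<union> (\<lambda>w. {p, w}) ` (W - {p})"
      using all_edges_insert[of p "W - {p}"] p by (simp add: insert_absorb)
    moreover have "W - {p} = {q, r, s, t}"
      using st p by auto
    ultimately show ?thesis
      by auto
  qed
  ultimately show ?thesis
    by (rule count_indep_subset)
qed

text \<open>This is the wheel with hub \<open>h\<close>. It has no vertex of degree two, but every
  edge \<open>e\<close> has an end \<open>x\<close> on the rim, where one edge is missing already;
  deleting \<open>e\<close> leaves a subset of K_5 minus two adjacent edges. The bound for the wheel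
  itself is sharp, 8 = 5 + 5 - 2.\<close>

lemma wheel_indep_212:
  assumes V: "finite V" and d: "distinct [a, b, c, d, h]" "{a, b, c, d, h} \<subseteq> V"
  shows "all_edges {a, b, c, d, h} - {{a, b}, {c, d}} \<in> indep_212 V"
proof (rule indep_212_if_deletions)
  let ?W = "{a, b, c, d, h}"
  let ?D = "all_edges ?W - {{a, b}, {c, d}}"
  have W: "card ?W = 5" "?W \<subseteq> V"
    using d by auto
  show DV: "?D \<subseteq> all_edges V"
    using all_edges_mono[OF W(2)] by auto
  show "?D - {e} \<in> indep_212 V" if e: "e \<in> ?D" for e
  proof -
    obtain x y where xy: "e = {x, y}" "x \<noteq> h" "x \<noteq> y" "x \<in> ?W" "y \<in> ?W"
    proof -
      obtain u v where "e = {u, v}" "u \<noteq> v" "u \<in> ?W" "v \<in> ?W"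
        using obtain_edge e by blast
      then show thesis
        using that[of u v] that[of v u] by (cases "u = h") (auto simp: insert_commute)
    qed
    \<comment> \<open>The partner of \<open>x\<close> in the missing edge at
      \<open>x\<close>.\<close>
    define x' where "x' = (if x = a then b else if x = b then a else if x = c then d else c)"
    have x': "x' \<in> ?W" "x' \<noteq> x" "{x, x'} \<in> {{a, b}, {c, d}}"
      using xy d by (auto simp: x'_def)
    then have "x' \<noteq> y"
      using e xy by auto
    then have "distinct [x, x', y]"
      using x' xy by auto
    then have "all_edges ?W - {{x, x'}, {x, y}} \<in> indep_212 V"
      by (rule K5_minus_two_adjacent_indep_212[OF V W xy(4) x'(1) xy(5)])
    moreover have "?D - {e} \<subseteq> all_edges ?W - {{x, x'}, {x, y}}"
      unfolding xy(1) using x'(3) by blast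
    ultimately show ?thesis
      by (rule count_indep_subset)
  qed
  \<comment> \<open>The triangle h, a, c with pendant edges at \<open>h\<close> to \<open>b\<close>
    and \<open>d\<close> witnesses rank 5.\<close>
  have "{{d, h}, {b, h}, {h, a}, {a, c}, {c, h}} \<subseteq> ?D"
    using d by (auto simp: doubleton_in_all_edges doubleton_eq_iff)
  then have "even_rank {{d, h}, {b, h}, {h, a}, {a, c}, {c, h}} \<le> even_rank ?D"
    by (rule even_rank_mono[OF V DV])
  then have rank: "5 \<le> even_rank ?D"
    using even_rank_triangle_two_pendants[OF V, of h a c b d] d by auto
  have "\<Union>{{d, h}, {b, h}, {h, a}, {a, c}, {c, h}} \<subseteq> \<Union>?D"
    by (rule Union_mono) fact
  then have "?W \<subseteq> \<Union>?D"
    by simp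
  moreover have "finite (\<Union>?D)"
    by (rule finite_subset[OF Union_all_edges, of _ ?W]) auto
  ultimately have "5 \<le> card (\<Union>?D)"
    using W(1) card_mono by metis
  moreover have "card ?D = 8"
  proof -
    have "{{a, b}, {c, d}} \<subseteq> all_edges ?W"
      using d by (simp add: doubleton_in_all_edges)
    then have "card ?D = card (all_edges ?W) - card {{a, b}, {c, d}}"
      by (intro card_Diff_subset) auto
    moreover have "card (all_edges ?W) = 10"
      using W(1) card_all_edges[of ?W] by (simp add: choose_two)
    moreover have "card {{a, b}, {c, d}} = 2"
      using d by (auto simp: card_2_iff doubleton_eq_iff)
    ultimately show ?thesis
      by simp
  qed
  ultimately show "int (card ?D) \<le> g_fun 2 1 2 ?D"
    using rank by (simp add: g_fun_212)
qed

lemma K5_minus_two_indep_212: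
  assumes V: "finite V" and W: "card W = 5" "W \<subseteq> V" and e: "e \<in> all_edges W" "f \<in> all_edges W" "e \<noteq> f"
  shows "all_edges W - {e, f} \<in> indep_212 V"
proof (cases "e \<inter> f = {}")
  case False
  then obtain p where p: "p \<in> e" "p \<in> f"
    by auto
  obtain q where q: "e = {p, q}" "p \<noteq> q" "p \<in> W" "q \<in> W"
    using obtain_edge[OF e(1)] p(1) by (metis empty_iff insert_commute insert_iff)
  obtain r where r: "f = {p, r}" "p \<noteq> r" "r \<in> W"
    using obtain_edge[OF e(2)] p(2) by (metis empty_iff insert_commute insert_iff)
  show ?thesis
    using K5_minus_two_adjacent_indep_212[OF V W, of p q r] q r e(3) by auto
next
  case True
  obtain a b where ab: "e = {a, b}" "a \<noteq> b" "a \<in> W" "b \<in> W"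
    using obtain_edge[OF e(1)] .
  obtain c d where cd: "f = {c, d}" "c \<noteq> d" "c \<in> W" "d \<in> W"
    using obtain_edge[OF e(2)] .
  have "card (W - {a, b, c, d}) = 1"
    using ab cd True W finite_subset[OF W(2) V] by (subst card_Diff_subset) auto
  then obtain h where "W - {a, b, c, d} = {h}"
    by (auto simp: card_1_singleton_iff)
  then have "W = {a, b, c, d, h}" "distinct [a, b, c, d, h]"
    using ab cd True by auto
  then show ?thesis
    using wheel_indep_212[OF V, of a b c d h] ab cd W by simp
qed

text \<open>Without the edge ab the vertex \<open>b\<close> keeps two neighbours in the
  three-element set \<open>A\<close>, so it is attached by a zero extension.\<close>

lemma bip_edges_vertex_deletion_indep_212:
  assumes V: "finite V" and A: "card A = 3" "A \<subseteq> V" and b: "b \<in> V" "b \<notin> A" "b \<notin> B" and a: "a \<in> A"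
    and I: "bip_edges A B \<in> indep_212 V"
  shows "bip_edges A (insert b B) - {{a, b}} \<in> indep_212 V"
proof -
  have "card (A - {a}) = 2"
    using A a finite_subset[OF A(2) V] by simp
  then obtain s t where st: "A - {a} = {s, t}"
    by (auto simp: card_2_iff)
  have "insert {b, s} (insert {b, t} (bip_edges A B)) \<in> indep_212 V"
  proof (rule zero_extension[OF V I])
    show "b \<notin> \<Union>(bip_edges A B)"
      using b by (auto simp: bip_edges_def)
  qed (use st A b in auto)
  moreover have "bip_edges A (insert b B) - {{a, b}} \<subseteq> insert {b, s} (insert {b, t} (bip_edges A B))"
  proof -
    have "bip_edges A (insert b B) = bip_edges A B \<union> (\<lambda>a. {b, a}) ` A"
      using bip_edges_insert[of b B A] by (simp add: bip_edges_commute)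
    moreover have "A = {a, s, t}"
      using st a by auto
    ultimately show ?thesis
      by (auto simp: insert_commute)
  qed
  ultimately show ?thesis
    by (rule count_indep_subset)
qed

text \<open>Each vertex of \<open>A\<close> is attached to the two vertices of \<open>B\<close> by a
  zero extension.\<close>

lemma K2m_indep_212:
  assumes V: "finite V" and B: "card B = 2" "B \<subseteq> V" and A: "finite A" "A \<subseteq> V" "A \<inter> B = {}"
  shows "bip_edges A B \<in> indep_212 V"
  using A
proof (induction A)
  case empty
  then show ?case
    by (simp add: bip_edges_def empty_indep_212)
next
  case (insert v A)
  obtain s t where st: "B = {s, t}"
    using B by (auto simp: card_2_iff)
  have "insert {v, s} (insert {v, t} (bip_edges A B)) \<in> indep_212 V"
  proof (rule zero_extension[OF V])
    show "v \<notin> \<Union>(bip_edges A B)"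
      using insert by (auto simp: bip_edges_def)
  qed (use insert B st in auto)
  moreover have "insert {v, s} (insert {v, t} (bip_edges A B)) = bip_edges (insert v A) B"
    unfolding bip_edges_insert st by auto
  ultimately show ?case
    by simp
qed

lemma card_3_obtain:
  assumes "card A = 3" "a \<in> A"
  obtains b c where "A = {a, b, c}" "distinct [a, b, c]"
proof -
  have "card (A - {a}) = 2"
    using assms by (simp add: card_ge_0_finite)
  then obtain b c where "A - {a} = {b, c}" "b \<noteq> c"
    by (auto simp: card_2_iff)
  then show thesis
    using that[of b c] assms(2) by auto
qed

text \<open>Deleting an edge ab leaves a zero extension by \<open>b\<close> of a complete bipartite
  graph with sides 3 and 2. The bound for the whole graph is sharp, 9 = 6 + 5 - 2.\<close>

lemma K33_indep_212:
  assumes V: "finite V" and A: "card A = 3" "A \<subseteq> V" and B: "card B = 3" "B \<subseteq> V" and dis: "A \<inter> B = {}"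
  shows "bip_edges A B \<in> indep_212 V"
proof (rule indep_212_if_deletions)
  have fin: "finite A" "finite B"
    using A B V finite_subset by blast+
  show sub: "bip_edges A B \<subseteq> all_edges V"
    using A B dis by (intro bip_edges_subset_all_edges) auto
  show "bip_edges A B - {e} \<in> indep_212 V" if "e \<in> bip_edges A B" for e
  proof -
    obtain a b where ab: "e = {a, b}" "a \<in> A" "b \<in> B"
      using \<open>e \<in> bip_edges A B\<close> by (auto simp: bip_edges_def)
    have "card (B - {b}) = 2"
      using ab B fin by simp
    then have "bip_edges A (B - {b}) \<in> indep_212 V"
      using A B dis fin by (intro K2m_indep_212[OF V]) auto
    then have "bip_edges A (insert b (B - {b})) - {{a, b}} \<in> indep_212 V"
      using A B ab dis by (intro bip_edges_vertex_deletion_indep_212[OF V]) auto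
    then show ?thesis
      using ab by (simp add: insert_absorb)
  qed
  obtain a where "a \<in> A"
    using A by fastforce
  then obtain a' a'' where a: "A = {a, a', a''}" "distinct [a, a', a'']"
    using card_3_obtain[OF A(1)] by blast
  obtain b where "b \<in> B"
    using B by fastforce
  then obtain b' b'' where b: "B = {b, b', b''}" "distinct [b, b', b'']"
    using card_3_obtain[OF B(1)] by blast
  have d: "distinct [a, a', a'', b, b', b'']" "{a, a', a'', b, b', b''} \<subseteq> V"
    using a b A B dis by auto
  \<comment> \<open>A spanning tree, listed as a path with two pendant edges; its five edges witness
    rank 5.\<close>
  have "{{b'', a''}, {a', b}, {b, a''}, {a'', b'}, {b', a}} \<subseteq> bip_edges A B"
    using a b by (auto simp: bip_edges_def)
  then have "even_rank {{b'', a''}, {a', b}, {b, a''}, {a'', b'}, {b', a}} \<le> even_rank (bip_edges A B)"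
    by (rule even_rank_mono[OF V sub])
  moreover have "even_rank {{b, a''}, {a'', b'}, {b', a}} \<ge> 3"
    using d by (intro even_rank_path3[OF V]) auto
  moreover have "even_rank {{b, a''}, {a'', b'}, {b', a}} + 1 \<le> even_rank (insert {a', b} {{b, a''}, {a'', b'}, {b', a}})"
    using d by (intro even_rank_pendant[OF V]) (auto simp: doubleton_in_all_edges)
  moreover have "even_rank {{a', b}, {b, a''}, {a'', b'}, {b', a}} + 1 \<le>
      even_rank (insert {b'', a''} {{a', b}, {b, a''}, {a'', b'}, {b', a}})"
    using d by (intro even_rank_pendant[OF V]) (auto simp: doubleton_in_all_edges)
  moreover have "\<Union>(bip_edges A B) = A \<union> B"
    using \<open>a \<in> A\<close> \<open>b \<in> B\<close> by (auto simp: bip_edges_def)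
  moreover have "card (A \<union> B) = 6"
    using A B dis fin by (simp add: card_Un_disjoint)
  moreover have "card (bip_edges A B) = 9"
    using card_bip_edges[OF dis] A B by simp
  ultimately show "int (card (bip_edges A B)) \<le> g_fun 2 1 2 (bip_edges A B)"
    by (simp add: g_fun_212)
qed

text \<open>Nine edges exceed 2 * 5 - 2, whereas one further deletion gives K_5 minus two
  edges.\<close>

lemma circuit_K5_minus:
  assumes "X \<in> copies {K5_minus} n"
  shows "circuit (all_edges {..<n}) (indep_212 {..<n}) X"
proof -
  obtain W a b where W: "card W = 5" "W \<subseteq> {..<n}" "a \<in> W" "b \<in> W" "a \<noteq> b" and X: "X = all_edges W - {{a, b}}"
    using assms unfolding copies_K5_minus by (elim exE conjE) (rule that)
  have finW: "finite W"
    using W(2) finite_subset by blast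
  show ?thesis
  proof (rule circuit_if_deletions_indep)
    show XE: "X \<subseteq> all_edges {..<n}"
      using all_edges_mono[OF W(2)] X by auto
    have "card (all_edges W) = 10"
      using W finW by (simp add: card_all_edges choose_two)
    then have "card X = 9"
      using W finW by (simp add: X doubleton_in_all_edges)
    moreover have "card (\<Union>X) \<le> 5"
      using Union_all_edges[of X W] X W finW card_mono[of W "\<Union>X"] by auto
    moreover have "g_fun 2 1 2 X \<le> 2 * int (card (\<Union>X)) - 2"
      by (simp add: g_fun_def incident_vertices_def)
    moreover have "X \<noteq> {}"
      using \<open>card X = 9\<close> by auto
    ultimately show "X \<notin> indep_212 {..<n}"
      unfolding count_indep_def by (auto simp: not_le intro!: exI[of _ X])
    fix e assume "e \<in> X"
    then show "X - {e} \<in> indep_212 {..<n}"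
      using K5_minus_two_indep_212[of "{..<n}" W "{a, b}" e] W
      by (auto simp: X doubleton_in_all_edges Diff_insert2[symmetric])
  qed (rule count_indep_subset)
qed

text \<open>The graph is bipartite, so its twelve edges exceed 2 * 7 - 1 - 2. Deleting an edge ab
  leaves K_{3,3} with \<open>b\<close> attached by two edges.\<close>

lemma circuit_K34:
  assumes "X \<in> copies {K34} n"
  shows "circuit (all_edges {..<n}) (indep_212 {..<n}) X"
proof -
  obtain A B where AB: "card A = 3" "card B = 4" "A \<inter> B = {}" "A \<union> B \<subseteq> {..<n}" and X: "X = bip_edges A B"
    using assms unfolding copies_K34 by (elim exE conjE) (rule that)
  have fin: "finite A" "finite B"
    using AB by (auto intro: card_ge_0_finite)
  show ?thesis
  proof (rule circuit_if_deletions_indep)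
    show XE: "X \<subseteq> all_edges {..<n}"
      unfolding X using AB by (intro bip_edges_subset_all_edges) auto
    have c: "card X = 12"
      using card_bip_edges[OF AB(3)] AB by (simp add: X)
    then have ne: "X \<noteq> {}"
      by auto
    have "beta X \<ge> 1"
      using XE AB(3) ne fin by (intro beta_pos_if_bipartite[of X "{..<n}" A B]) (auto simp: X finite_bip_edges)
    moreover have "card (\<Union>X) \<le> card (A \<union> B)"
      using fin by (intro card_mono) (auto simp: X bip_edges_def)
    moreover have "card (A \<union> B) = 7"
      using AB fin by (simp add: card_Un_disjoint)
    ultimately show "X \<notin> indep_212 {..<n}"
      using c ne unfolding count_indep_def
      by (auto simp: not_le g_fun_def incident_vertices_def intro!: exI[of _ X])
    fix e assume "e \<in> X"
    then obtain a b where ab: "e = {a, b}" "a \<in> A" "b \<in> B"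
      by (auto simp: X bip_edges_def)
    have "card (B - {b}) = 3"
      using ab AB fin by simp
    then have "bip_edges A (B - {b}) \<in> indep_212 {..<n}"
      using AB by (intro K33_indep_212) auto
    then have "bip_edges A (insert b (B - {b})) - {{a, b}} \<in> indep_212 {..<n}"
      using AB ab by (intro bip_edges_vertex_deletion_indep_212) auto
    then show "X - {e} \<in> indep_212 {..<n}"
      using ab by (simp add: insert_absorb X)
  qed (rule count_indep_subset)
qed

text \<open>Summing the independence inequalities of the components, a tight set with \<open>m\<close> components would
  satisfy \<open>2m \<le> 2\<close>.\<close>

lemma tight_212_connected:
  assumes V: "finite V" and T: "T \<in> indep_212 V" "T \<noteq> {}" "int (card T) = g_fun 2 1 2 T"
  shows "components T = {\<Union>T}"
proof -
  have TV: "T \<subseteq> all_edges V"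
    using T by (simp add: count_indep_def)
  note fin = finite_components[OF V TV]
  let ?B = "bip_components T"
  define S where "S C = {e \<in> T. e \<subseteq> C}" for C
  have finT: "finite T"
    using TV finite_all_edges[OF V] finite_subset by blast
  \<comment> \<open>A bipartite component stays bipartite as a graph of its own, which costs one
    more in the bound.\<close>
  have S_le: "int (card (S C)) \<le> 2 * int (card C) - 2 - (if C \<in> ?B then 1 else 0)" if C: "C \<in> components T" for C
  proof -
    obtain e where "e \<in> T" "e \<subseteq> C"
      using component_has_edge[OF TV C] .
    then have ne: "S C \<noteq> {}"
      by (auto simp: S_def)
    have sub: "S C \<subseteq> T"
      by (auto simp: S_def)
    have "int (card (S C)) \<le> g_fun 2 1 2 (S C)"
      using T(1) sub ne by (auto simp: count_indep_def)
    also have "\<dots> = 2 * int (card (\<Union>(S C))) - int (beta (S C)) - 2"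
      by (simp add: g_fun_def incident_vertices_def)
    finally have "int (card (S C)) \<le> 2 * int (card (\<Union>(S C))) - int (beta (S C)) - 2" .
    moreover have "card (\<Union>(S C)) \<le> card C"
      using fin(2)[OF C] by (intro card_mono) (auto simp: S_def)
    moreover have "beta (S C) \<ge> 1" if "C \<in> ?B"
      using bip_component_sides[OF TV that] sub ne TV finT finite_subset V
      by (intro beta_pos_if_bipartite[of _ V "side T C" "C - side T C"]) (auto simp: S_def)
    ultimately show ?thesis
      by auto
  qed
  have "T = (\<Union>C\<in>components T. S C)"
  proof -
    have "\<exists>C\<in>components T. e \<subseteq> C" if e: "e \<in> T" for e
    proof -
      obtain u v where uv: "e = {u, v}"
        using obtain_edge[of e V] TV e by blast
      then obtain C where "C \<in> components T" "u \<in> C"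
        using e Union_components[of T] by blast
      then show ?thesis
        using edge_in_component[OF TV e] uv by blast
    qed
    then show ?thesis
      by (auto simp: S_def)
  qed
  then have "card T \<le> (\<Sum>C\<in>components T. card (S C))"
    using card_UN_le[OF fin(1), of S] by simp
  then have "int (card T) \<le> (\<Sum>C\<in>components T. int (card (S C)))"
    by (metis of_nat_mono of_nat_sum)
  also have "\<dots> \<le> (\<Sum>C\<in>components T. 2 * int (card C) - 2 - (if C \<in> ?B then 1 else 0))"
    by (intro sum_mono S_le)
  also have "\<dots> = 2 * int (card (\<Union>T)) - 2 * int (card (components T)) - int (beta T)"
  proof -
    have "(\<Sum>C\<in>components T. if C \<in> ?B then 1 else 0 :: int) = int (beta T)"
      using fin(1) by (simp add: sum.If_cases beta_eq bip_components_def Int_def)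
    then show ?thesis
      using card_Union_components[OF V TV] by (simp add: sum_subtractf sum_distrib_left)
  qed
  finally have "card (components T) \<le> 1"
    using T(3) by (simp add: g_fun_def incident_vertices_def)
  moreover have "components T \<noteq> {}"
    using Union_components[of T] T(2) TV by (fastforce simp: all_edges_def)
  ultimately obtain C where C: "components T = {C}"
    using fin(1) card_0_eq[of "components T"] by (metis One_nat_def card_1_singleton_iff le_Suc_eq le_zero_eq)
  then show ?thesis
    using Union_components[of T] by simp
qed

text \<open>\<open>T\<close> is connected, so its closure lies in one complete bipartite or one
  complete graph on \<open>\<Union>T\<close>. The charges 2|V| - 3 and 2|V| - 2 are the values of
  \<open>g_fun 2 1 2 T\<close> for \<open>beta T\<close> equal to 1 and 0.\<close>

lemma span_tight_212:
  assumes T: "T \<in> indep_212 {..<n}" "T \<noteq> {}" "int (card T) = g_fun 2 1 2 T"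
  shows "\<exists>K. {e \<in> all_edges {..<n}. g_fun 2 1 2 (insert e T) = g_fun 2 1 2 T} \<subseteq> K \<and>
    spans (copies_212 n) K (card T)"
proof -
  have V: "finite {..<n}"
    by simp
  have TV: "T \<subseteq> all_edges {..<n}"
    using T by (simp add: count_indep_def)
  note comp = tight_212_connected[OF V T]
  let ?C = "\<Union>T"
  have Cn: "?C \<subseteq> {..<n}" and finC: "finite ?C"
    using Union_all_edges[OF TV] finite_subset by blast+
  \<comment> \<open>Both summands of \<open>g_fun_212\<close> are monotone, so if their sum is
    unchanged then so is each of them.\<close>
  have cl: "even_rank (insert e T) = even_rank T"
    if e: "e \<in> all_edges {..<n}" "g_fun 2 1 2 (insert e T) = g_fun 2 1 2 T" for e
  proof -
    have eT: "insert e T \<subseteq> all_edges {..<n}"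
      using TV e by auto
    have "card (\<Union>T) \<le> card (\<Union>(insert e T))"
      using finite_subset[OF Union_all_edges[OF eT]] by (intro card_mono) auto
    moreover have "even_rank T \<le> even_rank (insert e T)"
      by (rule even_rank_mono[OF V eT]) auto
    ultimately show ?thesis
      using e(2) by (simp add: g_fun_212)
  qed
  show ?thesis
  proof (cases "?C \<in> bip_components T")
    case True
    then have B: "bip_components T = {?C}" "nonbip_vertices T = {}"
      using comp by (auto simp: bip_components_def nonbip_vertices_def)
    note s = bip_component_sides[OF TV True]
    have c: "card (side T ?C) + card (?C - side T ?C) = card ?C"
      using s(1) finC card_Diff_subset[of "side T ?C" ?C] card_mono[of ?C "side T ?C"] finite_subset
      by fastforce
    have "spans (copies_212 n) (bip_edges (side T ?C) (?C - side T ?C)) (2 * (card (side T ?C) + card (?C - side T ?C)) - 3)"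
      using s Cn finC finite_subset[OF s(1)] by (intro spans_K34_bip) auto
    moreover have "2 * card ?C - 3 = card T"
      using T(3) B(1) by (simp add: g_fun_def incident_vertices_def beta_eq)
    ultimately have "spans (copies_212 n) (bip_edges (side T ?C) (?C - side T ?C)) (card T)"
      by (simp add: c)
    moreover have "{e \<in> all_edges {..<n}. g_fun 2 1 2 (insert e T) = g_fun 2 1 2 T} \<subseteq>
        bip_edges (side T ?C) (?C - side T ?C)"
      using even_rank_eq_insert[OF V TV _ cl] B by (auto simp: all_edges_empty)
    ultimately show ?thesis
      by blast
  next
    case False
    then have B: "bip_components T = {}" "nonbip_vertices T = ?C"
      using comp by (auto simp: bip_components_def nonbip_vertices_def)
    have "spans (copies_212 n) (all_edges ?C) (2 * card ?C - 2)"
      using spans_K5_minus_complete[OF finC Cn] .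
    moreover have "2 * card ?C - 2 = card T"
      using T(3) B(1) by (simp add: g_fun_def incident_vertices_def beta_eq)
    moreover have "{e \<in> all_edges {..<n}. g_fun 2 1 2 (insert e T) = g_fun 2 1 2 T} \<subseteq> all_edges ?C"
      using even_rank_eq_insert[OF V TV _ cl] B by auto
    ultimately show ?thesis
      by (intro exI[of _ "all_edges ?C"] conjI) simp_all
  qed
qed

theorem K5_minus_K34_matroid_maximal:
  "unique_maximal_H_matroid {K5_minus, K34} n (M_g 2 1 2 n) \<and>
    (\<forall>F. F \<subseteq> snd (complete_graph n) \<longrightarrow>
       int (rank_of (M_g 2 1 2 n) F) = val_H {K5_minus, K34} n F)"
proof -
  interpret count_function "all_edges {..<n}" "g_fun 2 1 2"
    by (rule count_function_212) simp
  show ?thesis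
  proof (rule unique_maximal_and_rank_eq_val)
    show "H_matroid {K5_minus, K34} n (M_g 2 1 2 n)"
      using matroid_count_indep circuit_K5_minus circuit_K34
      by (auto simp: H_matroid_def snd_complete_graph copies_212_iff)
    fix F assume "F \<subseteq> snd (complete_graph n)"
    then show "\<exists>I\<in>M_g 2 1 2 n. I \<subseteq> F \<and>
        (\<exists>Xs. proper_sequence (copies_212 n) Xs \<and> val_seq F Xs \<le> int (card I))"
      unfolding snd_complete_graph
    proof (rule spanning_sequence_exists[rotated])
      fix T assume T: "T \<in> indep_212 {..<n}" "tight T"
      then show "\<exists>K. cl T \<subseteq> K \<and> spans (copies_212 n) K (card T)"
        using span_tight_212[OF T(1)] by (simp add: tight_def cl_def)
    qed
  qed
qed

theorem theorem4p6:
  shows "(\<forall>n\<ge>4. unique_maximal_H_matroid {C4} n (M_g 1 1 0 n) \<and>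
            (\<forall>F. F \<subseteq> snd (complete_graph n) \<longrightarrow>
               int (rank_of (M_g 1 1 0 n) F) = val_H {C4} n F)) \<and>
         (\<forall>n\<ge>7. unique_maximal_H_matroid {K5_minus, K34} n (M_g 2 1 2 n) \<and>
            (\<forall>F. F \<subseteq> snd (complete_graph n) \<longrightarrow>
               int (rank_of (M_g 2 1 2 n) F) = val_H {K5_minus, K34} n F))"
  by (rule conjI; rule allI; rule impI; rule even_cycle_matroid_maximal K5_minus_K34_matroid_maximal)

end
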